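(* Let $I=[0,\gamma)$ with $0<\gamma\le\infty$, let $\varphi$ be an Orlicz function and let $w$ be a weight function on $I$ with $W(t)=\int_0^t w$. Suppose $w$ is regular. If the Orlicz-Lorentz space $\Lambda_{\varphi,w}$ on $I$, equipped with the Luxemburg norm, has the Daugavet property, then it is isometrically isomorphic to $L_1=L_1(I)$. If moreover $W(1)=1$, then $\Lambda_{\varphi,w}=L_1$ with equality of norms.
   Context: All Banach spaces are real. A Banach space $X$ has the Daugavet property if every rank-one operator $T:X\to X$ satisfies $\|\mathrm{Id}+T\|=1+\|T\|$, where $\mathrm{Id}$ is the identity operator. An Orlicz function is a convex function $\varphi:[0,\infty)\to[0,\infty)$ with $\varphi(0)=0$, not identically zero. A weight function is a decreasing (i.e. non-increasing), positive, locally integrable function $w$ on $I=[0,\gamma)$ with $W(t)=\int_0^t w<\infty$ for $t\in[0,\gamma)$; if $\gamma=\infty$ it is assumed that $\int_0^\infty w=\infty$. The weight $w$ is regular if there is a constant $K>1$ such that $W(2t)\ge K\,W(t)$ for all $t\in[0,\gamma/2)$. For measurable $f$ on $I$ (Lebesgue measure $m$), $d_f(\lambda)=m\{t:|f(t)|>\lambda\}$ and $f^*(t)=\inf\{\lambda>0:d_f(\lambda)\le t\}$. Put $\rho_{\varphi,w}(f)=\int_I\varphi(f^* )w$. Then $\Lambda_{\varphi,w}=\{f:\rho_{\varphi,w}(kf)<\infty\text{ for some }k>0\}$ with the Luxemburg norm $\|f\|_{\varphi,w}=\inf\{\epsilon>0:\rho_{\varphi,w}(f/\epsilon)\le 1\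}$.
   Formalization: Equality of norms fails for φ(u)=2u, w=1, γ=∞, where W(1)=1 but the norm is twice the L_1 norm. Under W(1)=1 it is proved that Λ=L_1 as sets with norm φ(1) times the L_1 norm, and equality of norms when φ(1)=1. *)

theory Defs
  imports "HOL-Analysis.Analysis"
begin

text \<open>
  The underlying space of \<open>\<Lambda>\<close> depends on the parameters \<open>\<gamma>\<close>, \<open>\<phi>\<close>, \<open>w\<close>, so it cannot be a type
  of class \<^class>\<open>banach\<close>; real normed spaces are therefore given by an explicit carrier.
\<close>

record 'a nspace =
  points :: "'a set"
  vzero :: 'a
  vadd :: "'a \<Rightarrow> 'a \<Rightarrow> 'a"
  vscale :: "real \<Rightarrow> 'a \<Rightarrow> 'a"
  vnorm :: "'a \<Rightarrow> real"

definition linear_map :: "'a nspace \<Rightarrow> 'b nspace \<Rightarrow> ('a \<Rightarrow> 'b) \<Rightarrow> bool" where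
  "linear_map X Y T \<longleftrightarrow>
     (\<forall>x\<in>points X. T x \<in> points Y) \<and>
     (\<forall>x\<in>points X. \<forall>y\<in>points X. T (vadd X x y) = vadd Y (T x) (T y)) \<and>
     (\<forall>c. \<forall>x\<in>points X. T (vscale X c x) = vscale Y c (T x))"

definition bounded_linear_map :: "'a nspace \<Rightarrow> 'b nspace \<Rightarrow> ('a \<Rightarrow> 'b) \<Rightarrow> bool" where
  "bounded_linear_map X Y T \<longleftrightarrow>
     linear_map X Y T \<and> (\<exists>C. \<forall>x\<in>points X. vnorm Y (T x) \<le> C * vnorm X x)"

definition op_norm :: "'a nspace \<Rightarrow> 'b nspace \<Rightarrow> ('a \<Rightarrow> 'b) \<Rightarrow> real" where
  "op_norm X Y T = Sup {vnorm Y (T x) | x. x \<in> points X \<and> vnorm X x \<le> 1}"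

definition rank_one :: "'a nspace \<Rightarrow> 'b nspace \<Rightarrow> ('a \<Rightarrow> 'b) \<Rightarrow> bool" where
  "rank_one X Y T \<longleftrightarrow>
     bounded_linear_map X Y T \<and>
     (\<exists>y\<in>points Y. y \<noteq> vzero Y \<and> T ` points X = {vscale Y c y | c. True})"

definition daugavet_property :: "'a nspace \<Rightarrow> bool" where
  "daugavet_property X \<longleftrightarrow>
     (\<forall>T. rank_one X X T \<longrightarrow> op_norm X X (\<lambda>x. vadd X x (T x)) = 1 + op_norm X X T)"

definition isometrically_isomorphic :: "'a nspace \<Rightarrow> 'b nspace \<Rightarrow> bool" where
  "isometrically_isomorphic X Y \<longleftrightarrow>
     (\<exists>U. linear_map X Y U \<and> bij_betw U (points X) (points Y) \<and>
          (\<forall>x\<in>points X. vnorm Y (U x) = vnorm X x))"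

definition ae_class :: "'a measure \<Rightarrow> ('a \<Rightarrow> real) \<Rightarrow> ('a \<Rightarrow> real) set" where
  "ae_class M f = {g \<in> borel_measurable M. AE t in M. g t = f t}"

text \<open>
  The normed space of almost-everywhere classes of functions from \<open>S\<close>, where \<open>S\<close> is a space of
  measurable functions and \<open>N\<close> a seminorm on it that takes equal values on functions equal almost
  everywhere (so that \<^term>\<open>N ` A\<close> is a singleton for every class \<open>A\<close>).
\<close>

definition ae_space ::
  "'a measure \<Rightarrow> ('a \<Rightarrow> real) set \<Rightarrow> (('a \<Rightarrow> real) \<Rightarrow> real) \<Rightarrow> ('a \<Rightarrow> real) set nspace" where
  "ae_space M S N =
     \<lparr> points = ae_class M ` S,
       vzero = ae_class M (\<lambda>_. 0),
       vadd = (\<lambda>A B. {h \<in> borel_measurable M. \<exists>f\<in>A. \<exists>g\<in>B. AE t in M. h t = f t + g t}),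
       vscale = (\<lambda>c A. {h \<in> borel_measurable M. \<exists>f\<in>A. AE t in M. h t = c * f t}),
       vnorm = (\<lambda>A. the_elem (N ` A)) \<rparr>"

definition interval_I :: "ereal \<Rightarrow> real set" where
  "interval_I \<gamma> = {t. 0 \<le> t \<and> ereal t < \<gamma>}"

abbreviation meas_I :: "ereal \<Rightarrow> real measure" where
  "meas_I \<gamma> \<equiv> lebesgue_on (interval_I \<gamma>)"

definition orlicz_function :: "(real \<Rightarrow> real) \<Rightarrow> bool" where
  "orlicz_function \<phi> \<longleftrightarrow>
     convex_on {0..} \<phi> \<and> (\<forall>u\<ge>0. 0 \<le> \<phi> u) \<and> \<phi> 0 = 0 \<and> (\<exists>u\<ge>0. \<phi> u \<noteq> 0)"

definition weight_primitive :: "(real \<Rightarrow> real) \<Rightarrow> real \<Rightarrow> real" where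
  "weight_primitive w t = (LINT s:{0..t}|lebesgue. w s)"

text \<open>
  Positivity and monotonicity are imposed on the open interval \<open>(0,\<gamma>)\<close> only: requiring them of a
  real-valued \<open>w\<close> at 0 as well would force \<open>w\<close> to be bounded and exclude weights such as
  \<open>1 / sqrt t\<close>.
\<close>

definition weight_function :: "ereal \<Rightarrow> (real \<Rightarrow> real) \<Rightarrow> bool" where
  "weight_function \<gamma> w \<longleftrightarrow>
     antimono_on (interval_I \<gamma> - {0}) w \<and>
     (\<forall>t\<in>interval_I \<gamma> - {0}. 0 < w t) \<and>
     (\<forall>t\<in>interval_I \<gamma>. set_integrable lebesgue {0..t} w) \<and>
     (\<gamma> = \<infinity> \<longrightarrow> (\<integral>\<^sup>+ t. ennreal (w t) \<partial>meas_I \<gamma>) = \<infinity>)"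

definition regular_weight :: "ereal \<Rightarrow> (real \<Rightarrow> real) \<Rightarrow> bool" where
  "regular_weight \<gamma> w \<longleftrightarrow>
     (\<exists>K>1. \<forall>t\<ge>0. ereal t < \<gamma> / 2 \<longrightarrow>
        weight_primitive w (2 * t) \<ge> K * weight_primitive w t)"

definition distribution :: "'a measure \<Rightarrow> ('a \<Rightarrow> real) \<Rightarrow> real \<Rightarrow> ennreal" where
  "distribution M f s = emeasure M {t \<in> space M. \<bar>f t\<bar> > s}"

text \<open>The value is \<^term>\<open>\<infinity>::ennreal\<close> if no \<open>s\<close> qualifies, e.g. at 0 for unbounded \<open>f\<close>.\<close>

definition decreasing_rearrangement :: "'a measure \<Rightarrow> ('a \<Rightarrow> real) \<Rightarrow> real \<Rightarrow> ennreal" where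
  "decreasing_rearrangement M f t =
     Inf {ennreal s | s. 0 < s \<and> distribution M f s \<le> ennreal t}"

text \<open>Extension of \<open>\<phi>\<close> to \<open>[0,\<infinity>]\<close> by its limit at \<open>\<infinity>\<close>.\<close>

definition orlicz_ext :: "(real \<Rightarrow> real) \<Rightarrow> ennreal \<Rightarrow> ennreal" where
  "orlicz_ext \<phi> x = (if x = \<infinity> then \<infinity> else ennreal (\<phi> (enn2real x)))"

definition modular ::
  "ereal \<Rightarrow> (real \<Rightarrow> real) \<Rightarrow> (real \<Rightarrow> real) \<Rightarrow> (real \<Rightarrow> real) \<Rightarrow> ennreal" where
  "modular \<gamma> \<phi> w f =
     (\<integral>\<^sup>+ t. orlicz_ext \<phi> (decreasing_rearrangement (meas_I \<gamma>) f t) * ennreal (w t) \<partial>meas_I \<gamma>)"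

definition luxemburg_norm ::
  "ereal \<Rightarrow> (real \<Rightarrow> real) \<Rightarrow> (real \<Rightarrow> real) \<Rightarrow> (real \<Rightarrow> real) \<Rightarrow> real" where
  "luxemburg_norm \<gamma> \<phi> w f = Inf {\<epsilon>. 0 < \<epsilon> \<and> modular \<gamma> \<phi> w (\<lambda>t. f t / \<epsilon>) \<le> 1}"

definition orlicz_lorentz_functions ::
  "ereal \<Rightarrow> (real \<Rightarrow> real) \<Rightarrow> (real \<Rightarrow> real) \<Rightarrow> (real \<Rightarrow> real) set" where
  "orlicz_lorentz_functions \<gamma> \<phi> w =
     {f \<in> borel_measurable (meas_I \<gamma>). \<exists>k>0. modular \<gamma> \<phi> w (\<lambda>t. k * f t) < \<infinity>}"

definition orlicz_lorentz ::
  "ereal \<Rightarrow> (real \<Rightarrow> real) \<Rightarrow> (real \<Rightarrow> real) \<Rightarrow> (real \<Rightarrow> real) set nspace" where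
  "orlicz_lorentz \<gamma> \<phi> w =
     ae_space (meas_I \<gamma>) (orlicz_lorentz_functions \<gamma> \<phi> w) (luxemburg_norm \<gamma> \<phi> w)"

definition L1_space :: "ereal \<Rightarrow> (real \<Rightarrow> real) set nspace" where
  "L1_space \<gamma> =
     ae_space (meas_I \<gamma>) {f. integrable (meas_I \<gamma>) f} (\<lambda>f. LINT t|meas_I \<gamma>. \<bar>f t\<bar>)"

end

(*
  The Orlicz-Lorentz modular is modular f = \<Lambda>(\<phi>|f|), where \<Lambda>(h) is the integral over s > 0 of W applied
  to the distribution function of h; \<Lambda> is subadditive because W is concave.

  Fix a in (0,\<gamma>) and c with \<phi>(c) W(a) = 1, let \<chi> be the indicator of [0,a], and test the Daugavet
  property on the norm-one rank-one operator f |-> -(mean of f over [0,a]) \<chi>. It yields f with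
  modular f <= 1 and modular ((f - \<alpha> \<chi>) / (2 - \<epsilon>)) > 1, where \<alpha> >= 0 is the mean of f. Convexity of \<phi>
  forces \<alpha> > (1 - \<epsilon>) c, and subadditivity of \<Lambda> together with the tangent bound
  W(x) <= W(a) - w(a) (a - x) forces the integral of min(max(f,0), c) over [0,a] to tend to 0 with \<epsilon>.
  So almost all of the mass of f on [0,a] sits on {f >= u}, a set of vanishing measure, for every
  u >= c. As W(s)/s decreases and \<phi>(u)/u increases, modular f <= 1 gives, in the limit,
  (W(s)/s) (\<phi>(u)/u) <= (W(a)/a) (\<phi>(c)/c) for all s and all u >= c. Taking u = c and varying a shows
  that w is constant, and then \<phi>(u)/u is constant for u >= c, hence \<phi> is linear by convexity.
*)
theory Submission
  imports Defs
begin

subsection \<open>Distribution functions and truncated integrals\<close>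

text \<open>The choice of c gives c \<chi> norm one, and mean / c is a functional of norm one that
  norms it. Two demands on f then pull apart: its mean over [0,a] has to be almost the largest that
  the unit ball allows, yet f - \<alpha> \<chi> has to have norm close to 2, while moderate positive
  values on [0,a] are partly cancelled by the subtraction. Only tall narrow spikes meet both
  demands. A spike of height u on a set of measure s has modular W(s) \<phi>(u), that is (W(s)/s)
  (\<phi>(u)/u) per unit of mass, against (W(a)/a) (\<phi>(c)/c) for the flat function c \<chi>.
  Narrower and taller spikes always cost at least as much; the existence of f says that they cost no
  more, and this is the source of rigidity.

  The obstacle is that the rearrangement of f + g is not bounded pointwise by f* + g*, so pointwise
  bounds obtained from convexity do not pass to rearrangements. This is why the argument runs
  through \<Lambda>, written with distribution functions only.\<close>

lemma emeasure_lborel_Ioi: "emeasure lborel {a::real<..} = \<infinity>"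
proof (rule ccontr)
  assume "emeasure lborel {a<..} \<noteq> \<infinity>"
  then obtain n :: nat where n: "emeasure lborel {a<..} < of_nat n"
    using ennreal_Ex_less_of_nat by (auto simp: less_top)
  have "emeasure lborel {a<..a + real n} \<le> emeasure lborel {a<..}"
    by (intro emeasure_mono) auto
  with n show False by (simp add: ennreal_of_nat_eq_real_of_nat)
qed

text \<open>\<open>h x\<close> is the length of the set of levels s > 0 below it; Tonelli does the
  rest. Infinite values of h are covered because a half-line has infinite length. The factor u
  serves once as the weight and once as a cut-off to an initial segment.\<close>

lemma layer_cake:
  fixes h u :: "'a \<Rightarrow> ennreal"
  assumes "sigma_finite_measure M"
    and [measurable]: "h \<in> borel_measurable M" "u \<in> borel_measurable M"
  shows "(\<integral>\<^sup>+x. h x * u x \<partial>M)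
    = (\<integral>\<^sup>+s\<in>{0<..}. (\<integral>\<^sup>+x. u x * indicator {x. ennreal s < h x} x \<partial>M) \<partial>lborel)"
proof -
  interpret M: sigma_finite_measure M by fact
  interpret pair_sigma_finite M lborel ..
  have h: "h x = (\<integral>\<^sup>+s. indicator {s. 0 < s \<and> ennreal s < h x} s \<partial>lborel)" for x
  proof (cases "h x")
    case (real r)
    then have "{s. 0 < s \<and> ennreal s < h x} = {0<..<r}" by (auto simp: ennreal_less_iff)
    with real show ?thesis by simp
  next
    case top
    then have "{s. 0 < s \<and> ennreal s < h x} = {0<..}" by auto
    with top show ?thesis by (simp add: emeasure_lborel_Ioi)
  qed
  have [measurable]: "Measurable.pred (M \<Otimes>\<^sub>M lborel) (\<lambda>p. ennreal (snd p) < h (fst p))"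
    by measurable
  let ?f = "\<lambda>p. u (fst p) * indicator {p. 0 < snd p \<and> ennreal (snd p) < h (fst p)} p"
  have [measurable]: "?f \<in> borel_measurable (M \<Otimes>\<^sub>M lborel)" by measurable
  have "(\<integral>\<^sup>+x. h x * u x \<partial>M) = (\<integral>\<^sup>+x. (\<integral>\<^sup>+s. ?f (x, s) \<partial>lborel) \<partial>M)"
  proof (rule nn_integral_cong)
    fix x assume "x \<in> space M"
    have "(\<integral>\<^sup>+s. ?f (x, s) \<partial>lborel)
        = (\<integral>\<^sup>+s. u x * indicator {s. 0 < s \<and> ennreal s < h x} s \<partial>lborel)"
      by (intro nn_integral_cong) (auto simp: indicator_def)
    also have "\<dots> = u x * h x"
      by (subst nn_integral_cmult) (auto simp: h[symmetric])
    finally show "h x * u x = (\<integral>\<^sup>+s. ?f (x, s) \<partial>lborel)" by (simp add: mult.commute)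
  qed
  also have "\<dots> = (\<integral>\<^sup>+s. (\<integral>\<^sup>+x. ?f (x, s) \<partial>M) \<partial>lborel)"
    by (rule Fubini'[symmetric]) measurable
  also have "\<dots> = (\<integral>\<^sup>+s\<in>{0<..}. (\<integral>\<^sup>+x. u x * indicator {x. ennreal s < h x} x \<partial>M) \<partial>lborel)"
    by (intro nn_integral_cong) (auto simp: indicator_def intro!: nn_integral_cong)
  finally show ?thesis .
qed

lemma distribution_antimono:
  assumes "f \<in> borel_measurable M" "s \<le> t"
  shows "distribution M f t \<le> distribution M f s"
  unfolding distribution_def using assms by (intro emeasure_mono) auto

lemma distribution_mono:
  assumes "g \<in> borel_measurable M" "\<And>x. x \<in> space M \<Longrightarrow> \<bar>f x\<bar> \<le> \<bar>g x\<bar>"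
  shows "distribution M f s \<le> distribution M g s"
  unfolding distribution_def using assms by (intro emeasure_mono) force+

lemma borel_measurable_antimono_ennreal:
  fixes f :: "real \<Rightarrow> ennreal"
  assumes "antimono f"
  shows "f \<in> borel_measurable borel"
proof (rule borel_measurableI_greater)
  fix y
  have "is_interval {x. y < f x}"
    using assms unfolding is_interval_1 antimono_def by (blast intro: less_le_trans)
  then show "{x \<in> space borel. y < f x} \<in> sets borel"
    using real_interval_borel_measurable[of "{x. y < f x}"] by simp
qed

lemma measurable_distribution [measurable]:
  assumes "f \<in> borel_measurable M"
  shows "distribution M f \<in> borel_measurable borel"
  using distribution_antimono[OF assms]
  by (intro borel_measurable_antimono_ennreal) (auto simp: antimono_def)

lemma layer_cake_abs:
  assumes "sigma_finite_measure M" and [measurable]: "f \<in> borel_measurable M"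
  shows "(\<integral>\<^sup>+x. ennreal \<bar>f x\<bar> \<partial>M) = (\<integral>\<^sup>+s\<in>{0<..}. distribution M f s \<partial>lborel)"
proof -
  have "(\<integral>\<^sup>+x. ennreal \<bar>f x\<bar> \<partial>M) = (\<integral>\<^sup>+x. ennreal \<bar>f x\<bar> * 1 \<partial>M)" by simp
  also have "\<dots> = (\<integral>\<^sup>+s\<in>{0<..}. (\<integral>\<^sup>+x. 1 * indicator {x. ennreal s < ennreal \<bar>f x\<bar>} x \<partial>M) \<partial>lborel)"
    by (rule layer_cake[OF assms(1)]) measurable
  also have "\<dots> = (\<integral>\<^sup>+s\<in>{0<..}. distribution M f s \<partial>lborel)"
  proof (intro nn_integral_cong, goal_cases)
    case (1 s)
    have "(\<integral>\<^sup>+x. 1 * indicator {x. ennreal s < ennreal \<bar>f x\<bar>} x \<partial>M)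
        = (\<integral>\<^sup>+x. indicator {x\<in>space M. s < \<bar>f x\<bar>} x \<partial>M)" if "0 < s"
      using that by (intro nn_integral_cong) (auto simp: indicator_def ennreal_less_iff)
    also have "\<dots> = distribution M f s" if "0 < s"
      unfolding distribution_def by simp
    finally show ?case by (auto simp: indicator_def)
  qed
  finally show ?thesis .
qed

text \<open>
  A truncated integral is the infimum of \<open>c \<tau> + \<integral> (\<bar>f\<bar> - c)\<^sup>+\<close> over \<open>c \<ge> 0\<close>, which makes it subadditive.
\<close>

definition truncated_integral :: "'a measure \<Rightarrow> ennreal \<Rightarrow> ('a \<Rightarrow> real) \<Rightarrow> ennreal" where
  "truncated_integral M \<tau> f = (\<integral>\<^sup>+s\<in>{0<..}. min (distribution M f s) \<tau> \<partial>lborel)"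

text \<open>\<open>ennreal\<close> sends negative numbers to 0, so the left integrand is the
  positive part of |f| - c, whose distribution function is that of f shifted by c.\<close>

lemma integral_excess:
  assumes "sigma_finite_measure M" and [measurable]: "f \<in> borel_measurable M" and "0 \<le> c"
  shows "(\<integral>\<^sup>+x. ennreal (\<bar>f x\<bar> - c) \<partial>M) = (\<integral>\<^sup>+s\<in>{c<..}. distribution M f s \<partial>lborel)"
proof -
  have "(\<integral>\<^sup>+x. ennreal (\<bar>f x\<bar> - c) \<partial>M) = (\<integral>\<^sup>+x. ennreal \<bar>max 0 (\<bar>f x\<bar> - c)\<bar> \<partial>M)"
    by (intro nn_integral_cong) (auto simp: max_def ennreal_neg)
  also have "\<dots> = (\<integral>\<^sup>+s\<in>{0<..}. distribution M (\<lambda>x. max 0 (\<bar>f x\<bar> - c)) s \<partial>lborel)"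
    by (rule layer_cake_abs[OF assms(1)]) measurable
  also have "\<dots> = (\<integral>\<^sup>+s. distribution M f (c + 1 * s) * indicator {c<..} (c + 1 * s) \<partial>lborel)"
  proof (intro nn_integral_cong, goal_cases)
    case (1 s)
    have "{x \<in> space M. \<bar>max 0 (\<bar>f x\<bar> - c)\<bar> > s} = {x \<in> space M. \<bar>f x\<bar> > c + s}" if "0 < s"
      using that by auto
    then show ?case by (auto simp: distribution_def indicator_def)
  qed
  also have "\<dots> = (\<integral>\<^sup>+s\<in>{c<..}. distribution M f s \<partial>lborel)"
    by (subst nn_integral_real_affine[where c=1 and t=c]) auto
  finally show ?thesis .
qed

lemma truncated_integral_le:
  assumes "sigma_finite_measure M" and [measurable]: "f \<in> borel_measurable M" and "0 \<le> c"
  shows "truncated_integral M \<tau> f \<le> c * \<tau> + (\<integral>\<^sup>+x. ennreal (\<bar>f x\<bar> - c) \<partial>M)"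
proof -
  have "truncated_integral M \<tau> f \<le>
      (\<integral>\<^sup>+s. \<tau> * indicator {0<..c} s + distribution M f s * indicator {c<..} s \<partial>lborel)"
    unfolding truncated_integral_def using \<open>0 \<le> c\<close>
    by (intro nn_integral_mono) (auto simp: indicator_def min_def)
  also have "\<dots> = \<tau> * ennreal c + (\<integral>\<^sup>+s\<in>{c<..}. distribution M f s \<partial>lborel)"
    using \<open>0 \<le> c\<close> by (subst nn_integral_add) (auto simp: nn_integral_cmult)
  finally show ?thesis using integral_excess[OF assms] by (simp add: mult.commute)
qed

text \<open>The optimal c is the infimum of the levels at which the distribution function has
  dropped to \<tau>, that is, the decreasing rearrangement at \<tau>. Below c the minimum is \<tau>,
  beyond c it is the distribution function. Finiteness of the integral guarantees that such levels
  exist.\<close>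

lemma truncated_integral_attained:
  assumes "sigma_finite_measure M" and [measurable]: "f \<in> borel_measurable M"
    and "\<tau> \<noteq> 0" "truncated_integral M \<tau> f \<noteq> \<infinity>"
  obtains c where "0 \<le> c" "c * \<tau> + (\<integral>\<^sup>+x. ennreal (\<bar>f x\<bar> - c) \<partial>M) = truncated_integral M \<tau> f"
proof -
  define S where "S = {s. 0 < s \<and> distribution M f s \<le> \<tau>}"
  have "S \<noteq> {}"
  proof
    assume "S = {}"
    then have "\<tau> \<le> distribution M f s" if "0 < s" for s using that by (force simp: S_def)
    then have "\<tau> * indicator {0<..} s \<le> min (distribution M f s) \<tau> * indicator {0<..} s" for s :: real
      by (auto simp: indicator_def)
    then have "(\<integral>\<^sup>+s. \<tau> * indicator {0<..} (s::real) \<partial>lborel) \<le> truncated_integral M \<tau> f"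
      unfolding truncated_integral_def by (rule nn_integral_mono)
    moreover have "(\<integral>\<^sup>+s. \<tau> * indicator {0<..} (s::real) \<partial>lborel) = \<infinity>"
      using \<open>\<tau> \<noteq> 0\<close> by (simp add: nn_integral_cmult ennreal_mult_top emeasure_lborel_Ioi)
    ultimately show False using assms(4) by (simp add: top_unique)
  qed
  define c where "c = Inf S"
  have "0 \<le> c" unfolding c_def using \<open>S \<noteq> {}\<close> by (intro cInf_greatest) (auto simp: S_def)
  have bdd: "bdd_below S" by (rule bdd_belowI[of _ 0]) (auto simp: S_def)
  have below: "\<tau> \<le> distribution M f s" if "0 < s" "s < c" for s
  proof (rule ccontr)
    assume "\<not> \<tau> \<le> distribution M f s"
    then have "s \<in> S" using that by (auto simp: S_def)
    then show False using cInf_lower[OF _ bdd] that by (force simp: c_def)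
  qed
  have above: "distribution M f s \<le> \<tau>" if "c < s" for s
  proof -
    obtain r where "r \<in> S" "r < s" using \<open>S \<noteq> {}\<close> \<open>c < s\<close> cInf_lessD unfolding c_def by blast
    then show ?thesis using distribution_antimono[of f M r s] by (auto simp: S_def intro: order_trans)
  qed
  have "truncated_integral M \<tau> f =
      (\<integral>\<^sup>+s. \<tau> * indicator {0<..c} s + distribution M f s * indicator {c<..} s \<partial>lborel)"
    unfolding truncated_integral_def
  proof (intro nn_integral_cong_AE)
    \<comment> \<open>The level c itself is excluded, since the distribution function may already be
      below \<tau> there.\<close>
    have "AE s in lborel. s \<noteq> c" by (rule AE_lborel_singleton)
    then show "AE s in lborel. min (distribution M f s) \<tau> * indicator {0<..} s =
        \<tau> * indicator {0<..c} s + distribution M f s * indicator {c<..} s"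
      by eventually_elim (use \<open>0 \<le> c\<close> below above in \<open>auto simp: indicator_def min_absorb1 min_absorb2\<close>)
  qed
  also have "\<dots> = \<tau> * ennreal c + (\<integral>\<^sup>+s\<in>{c<..}. distribution M f s \<partial>lborel)"
    using \<open>0 \<le> c\<close> by (subst nn_integral_add) (auto simp: nn_integral_cmult)
  finally show ?thesis
    using that[OF \<open>0 \<le> c\<close>] integral_excess[OF assms(1,2) \<open>0 \<le> c\<close>] by (simp add: mult.commute)
qed

text \<open>If c is optimal for f and d for g, then c + d is a competitor for f + g: the excess of
  |f + g| over c + d is at most the sum of the two excesses.\<close>

lemma truncated_integral_subadd:
  assumes M: "sigma_finite_measure M"
    and [measurable]: "f \<in> borel_measurable M" "g \<in> borel_measurable M"
  shows "truncated_integral M \<tau> (\<lambda>x. f x + g x) \<le> truncated_integral M \<tau> f + truncated_integral M \<tau> g"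
proof (cases "\<tau> = 0 \<or> truncated_integral M \<tau> f = \<infinity> \<or> truncated_integral M \<tau> g = \<infinity>")
  case True
  then show ?thesis by (auto simp: truncated_integral_def)
next
  case False
  obtain c where c: "0 \<le> c" "c * \<tau> + (\<integral>\<^sup>+x. ennreal (\<bar>f x\<bar> - c) \<partial>M) = truncated_integral M \<tau> f"
    using truncated_integral_attained[OF M assms(2)] False by blast
  obtain d where d: "0 \<le> d" "d * \<tau> + (\<integral>\<^sup>+x. ennreal (\<bar>g x\<bar> - d) \<partial>M) = truncated_integral M \<tau> g"
    using truncated_integral_attained[OF M assms(3)] False by blast
  have "truncated_integral M \<tau> (\<lambda>x. f x + g x)
      \<le> ennreal (c + d) * \<tau> + (\<integral>\<^sup>+x. ennreal (\<bar>f x + g x\<bar> - (c + d)) \<partial>M)"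
    using c d by (intro truncated_integral_le[OF M]) auto
  also have "(\<integral>\<^sup>+x. ennreal (\<bar>f x + g x\<bar> - (c + d)) \<partial>M)
      \<le> (\<integral>\<^sup>+x. ennreal (\<bar>f x\<bar> - c) + ennreal (\<bar>g x\<bar> - d) \<partial>M)"
  proof (intro nn_integral_mono)
    fix x
    have "ennreal (\<bar>f x + g x\<bar> - (c + d)) \<le> ennreal (max 0 (\<bar>f x\<bar> - c) + max 0 (\<bar>g x\<bar> - d))"
      by (intro ennreal_leI) linarith
    also have "\<dots> = ennreal (max 0 (\<bar>f x\<bar> - c)) + ennreal (max 0 (\<bar>g x\<bar> - d))"
      by (rule ennreal_plus) auto
    finally show "ennreal (\<bar>f x + g x\<bar> - (c + d)) \<le> ennreal (\<bar>f x\<bar> - c) + ennreal (\<bar>g x\<bar> - d)"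
      by (auto simp: max_def ennreal_neg split: if_splits)
  qed
  also have "\<dots> = (\<integral>\<^sup>+x. ennreal (\<bar>f x\<bar> - c) \<partial>M) + (\<integral>\<^sup>+x. ennreal (\<bar>g x\<bar> - d) \<partial>M)"
    by (rule nn_integral_add) auto
  finally show ?thesis
    using c d by (simp add: ennreal_plus algebra_simps add_mono flip: c(2) d(2))
qed

subsection \<open>The Lorentz functional of a decreasing weight\<close>

locale weighted_interval =
  fixes \<gamma> :: ereal and w :: "real \<Rightarrow> real"
  assumes \<gamma>_pos: "0 < \<gamma>" and weight: "weight_function \<gamma> w"
begin

abbreviation "I \<equiv> interval_I \<gamma>"
abbreviation "M \<equiv> meas_I \<gamma>"

lemma I_iff: "t \<in> I \<longleftrightarrow> 0 \<le> t \<and> ereal t < \<gamma>"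
  by (simp add: interval_I_def)

lemma I_down: "t \<in> I \<Longrightarrow> 0 \<le> s \<Longrightarrow> s \<le> t \<Longrightarrow> s \<in> I"
  unfolding I_iff by (meson ereal_less_eq(3) le_less_trans)

lemma is_interval_I: "is_interval I"
  unfolding is_interval_1 using I_down by (meson I_iff order_trans)

lemma I_borel [measurable]: "I \<in> sets borel"
  by (rule real_interval_borel_measurable[OF is_interval_I])

lemma I_lebesgue [measurable]: "I \<in> sets lebesgue"
  using I_borel by simp

lemma space_M [simp]: "space M = I"
  by simp

lemma sets_M_I: "A \<in> sets borel \<Longrightarrow> A \<subseteq> I \<Longrightarrow> A \<in> sets M"
  by (auto simp: sets_restrict_space image_iff)

lemma emeasure_M: "A \<in> sets borel \<Longrightarrow> A \<subseteq> I \<Longrightarrow> emeasure M A = emeasure lborel A"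
  by (subst emeasure_restrict_space) auto

lemma measurable_M: "f \<in> borel_measurable borel \<Longrightarrow> f \<in> borel_measurable M"
  by (intro measurable_restrict_space1) (simp add: measurable_completion)

lemma measurable_ennreal_M [measurable]: "ennreal \<in> borel_measurable M"
  by (rule measurable_M) simp

lemma sigma_finite_M: "sigma_finite_measure M"
proof (intro sigma_finite_measure_restrict_space)
  show "sigma_finite_measure (lebesgue :: real measure)"
  proof
    show "\<exists>A. countable A \<and> A \<subseteq> sets (lebesgue :: real measure) \<and> \<Union>A = space lebesgue \<and> (\<forall>a\<in>A. emeasure lebesgue a \<noteq> \<infinity>)"
    proof -
      obtain A :: "real set set" where A: "countable A" "A \<subseteq> sets lborel" "\<Union>A = space lborel"
        "\<forall>a\<in>A. emeasure lborel a \<noteq> \<infinity>"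
        using lborel.sigma_finite_countable by auto
      moreover have "a \<in> sets lebesgue \<and> emeasure lebesgue a \<noteq> \<infinity>" if "a \<in> A" for a
        using A that by (auto simp: subset_iff)
      ultimately show ?thesis by (intro exI[of _ A] conjI) auto
    qed
  qed
qed simp

lemma AE_nonzero: "AE t in M. t \<noteq> 0"
proof (subst AE_restrict_space_iff)
  have "AE t in lborel. t \<noteq> (0::real)" by (rule AE_lborel_singleton)
  then show "AE t in lebesgue. t \<in> I \<longrightarrow> t \<noteq> 0" by (intro AE_completion) auto
qed simp

lemma w_antimono: "0 < s \<Longrightarrow> s \<le> t \<Longrightarrow> t \<in> I \<Longrightarrow> w t \<le> w s"
  using weight I_down[of t s] unfolding weight_function_def
  by (auto simp: monotone_on_def)

lemma w_pos: "0 < t \<Longrightarrow> t \<in> I \<Longrightarrow> 0 < w t"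
  using weight unfolding weight_function_def by auto

lemma w_integrable: "t \<in> I \<Longrightarrow> set_integrable lebesgue {0..t} w"
  using weight unfolding weight_function_def by auto

text \<open>Superlevel sets of w are intervals away from 0. The value at 0 is unconstrained and may
  add that one point.\<close>

lemma w_measurable [measurable]: "w \<in> borel_measurable M"
proof (rule borel_measurableI_greater)
  fix y
  have "is_interval {t \<in> I - {0}. y < w t}"
    unfolding is_interval_1
  proof safe
    fix a b x assume *: "a \<in> I" "b \<in> I" "y < w b" "a \<le> x" "x \<le> b" "a \<noteq> 0"
    then have "0 < x" by (auto simp: I_iff)
    with * show "x \<in> I" "y < w x"
      using I_down[of b x] w_antimono[of x b] by auto
  qed (auto simp: I_iff)
  then have 1: "{t \<in> I - {0}. y < w t} \<in> sets M"
    by (intro sets_M_I real_interval_borel_measurable) auto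
  have "0 \<in> I" using \<gamma>_pos by (simp add: I_iff zero_ereal_def)
  then have 2: "(if y < w 0 then {0} else {}) \<in> sets M" by (auto intro!: sets_M_I)
  have "{t \<in> space M. y < w t} = {t \<in> I - {0}. y < w t} \<union> (if y < w 0 then {0} else {})"
    using \<open>0 \<in> I\<close> by auto
  then show "{t \<in> space M. y < w t} \<in> sets M" using sets.Un[OF 1 2] by (simp only:)
qed

text \<open>This is W as a map on [0,\<infinity>], so that it can be applied to distribution
  functions, which may be infinite. Arguments beyond the length of I give the total mass of w,
  whence the bound \<open>x \<le> emeasure M I\<close> in exact formulas.\<close>

definition primitive :: "ennreal \<Rightarrow> ennreal" where
  "primitive x = (\<integral>\<^sup>+t. ennreal (w t) * indicator {t. ennreal t < x} t \<partial>M)"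

lemma primitive_mono: "x \<le> y \<Longrightarrow> primitive x \<le> primitive y"
  unfolding primitive_def by (intro nn_integral_mono) (auto simp: indicator_def)

lemma emeasure_initial:
  assumes "x \<le> emeasure M I"
  shows "emeasure M {t\<in>I. ennreal t < x} = x"
proof (cases x)
  case top
  then have "{t\<in>I. ennreal t < x} = I" by auto
  with top assms show ?thesis by (simp add: top_unique)
next
  case (real r)
  have sub: "{0..<r} \<subseteq> I"
  proof
    fix t assume t: "t \<in> {0..<r}"
    show "t \<in> I"
    proof (rule ccontr)
      assume "t \<notin> I"
      then have "I \<subseteq> {0..t}" using t I_down by (force simp: I_iff)
      then have "emeasure lborel I \<le> emeasure lborel {0..t}" by (intro emeasure_mono) auto
      then have "x \<le> ennreal t" using assms t by (simp add: emeasure_M)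
      with real t show False by (simp add: ennreal_le_iff)
    qed
  qed
  then have "{t\<in>I. ennreal t < x} = {0..<r}"
    using real by (auto simp: I_iff ennreal_less_iff)
  with real sub show ?thesis by (simp add: emeasure_M)
qed

text \<open>Both {t < x} and {w > y} are initial segments of I up to the point 0. They are therefore
  nested, and their intersection has the smaller of the two measures.\<close>

lemma primitive_eq_min:
  assumes "x \<le> emeasure M I"
  shows "primitive x = (\<integral>\<^sup>+y\<in>{0<..}. min x (distribution M w y) \<partial>lborel)"
proof -
  have "primitive x = (\<integral>\<^sup>+y\<in>{0<..}. (\<integral>\<^sup>+t. indicator {t. ennreal t < x} t
      * indicator {t. ennreal y < ennreal (w t)} t \<partial>M) \<partial>lborel)"
    unfolding primitive_def by (rule layer_cake[OF sigma_finite_M]) measurable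
  also have "\<dots> = (\<integral>\<^sup>+y\<in>{0<..}. min x (distribution M w y) \<partial>lborel)"
  proof (intro nn_integral_cong, goal_cases)
    case (1 y)
    define A where "A = {t\<in>I. ennreal t < x}"
    define B where "B = {t\<in>I. y < \<bar>w t\<bar>}"
    have [measurable]: "A \<in> sets M" "B \<in> sets M"
    proof -
      have "{t\<in>space M. ennreal t < x} \<in> sets M" by measurable
      then show "A \<in> sets M" by (simp add: A_def)
      have "{t\<in>space M. y < \<bar>w t\<bar>} \<in> sets M" by measurable
      then show "B \<in> sets M" by (simp add: B_def)
    qed
    have "(\<integral>\<^sup>+t. indicator {t. ennreal t < x} t * indicator {t. ennreal y < ennreal (w t)} t \<partial>M)
        = min x (distribution M w y)" if "0 < y"
    proof -
      have "(\<integral>\<^sup>+t. indicator {t. ennreal t < x} t * indicator {t. ennreal y < ennreal (w t)} t \<partial>M)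
          = (\<integral>\<^sup>+t. indicator (A \<inter> B) t \<partial>M)"
      proof (rule nn_integral_cong_AE)
        show "AE t in M. indicator {t. ennreal t < x} t * indicator {t. ennreal y < ennreal (w t)} t
            = (indicator (A \<inter> B) t :: ennreal)"
          using AE_nonzero AE_space
        proof eventually_elim
          case (elim t)
          then have "0 < t" "t \<in> I" by (auto simp: I_iff)
          then show ?case
            using w_pos[of t] that by (auto simp: A_def B_def indicator_def ennreal_less_iff)
        qed
      qed
      also have "\<dots> = emeasure M (A \<inter> B)" by simp
      also have "\<dots> = min (emeasure M A) (emeasure M B)"
      \<comment> \<open>If a point s \<noteq> 0 of A lies outside B, monotonicity of w puts every
        nonzero point of B to the left of s, hence into A.\<close>
      proof (cases "A - {0} \<subseteq> B")
        case True
        have "AE t in M. t \<in> A \<longrightarrow> t \<in> B" using AE_nonzero True by (auto elim: eventually_mono)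
        moreover from this have "emeasure M (A \<inter> B) = emeasure M A"
          by (intro emeasure_eq_AE) auto
        ultimately show ?thesis
          using emeasure_mono_AE[of A B M] by (simp add: min_absorb1)
      next
        case False
        then obtain s where s: "s \<in> A" "s \<noteq> 0" "s \<notin> B" by auto
        have "t \<in> A" if "t \<in> B" "t \<noteq> 0" for t
        proof -
          have "0 < s" "0 < t" "s \<in> I" "t \<in> I"
            using s that by (auto simp: A_def B_def I_iff)
          then have "t < s"
            using s that w_antimono[of s t] w_pos[of s] w_pos[of t]
            by (force simp: A_def B_def)
          then have "ennreal t \<le> ennreal s" by (simp add: ennreal_leI)
          with s \<open>t \<in> I\<close> show ?thesis by (auto simp: A_def)
        qed
        then have "AE t in M. t \<in> B \<longrightarrow> t \<in> A" using AE_nonzero by (auto elim: eventually_mono)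
        moreover from this have "emeasure M (A \<inter> B) = emeasure M B"
          by (intro emeasure_eq_AE) auto
        ultimately show ?thesis
          using emeasure_mono_AE[of B A M] by (simp add: min_absorb2)
      qed
      also have "\<dots> = min x (distribution M w y)"
        using emeasure_initial[OF assms] by (simp add: A_def B_def distribution_def)
      finally show ?thesis .
    qed
    then show ?case by (auto simp: indicator_def)
  qed
  finally show ?thesis .
qed

text \<open>The Lorentz functional, the integral of f* w, in layer cake form: the level set {f* > s}
  is an initial segment of length \<open>distribution M f s\<close>.\<close>

definition lorentz :: "(real \<Rightarrow> real) \<Rightarrow> ennreal" where
  "lorentz f = (\<integral>\<^sup>+s\<in>{0<..}. primitive (distribution M f s) \<partial>lborel)"

lemma lorentz_mono:
  assumes "g \<in> borel_measurable M" "\<And>t. t \<in> I \<Longrightarrow> \<bar>f t\<bar> \<le> \<bar>g t\<bar>"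
  shows "lorentz f \<le> lorentz g"
  unfolding lorentz_def
proof (intro nn_integral_mono mult_right_mono primitive_mono)
  show "distribution M f s \<le> distribution M g s" for s
    using assms by (intro distribution_mono) simp_all
qed simp

lemma distribution_le_I: "distribution M f s \<le> emeasure M I"
  unfolding distribution_def using sets.top[of M] by (intro emeasure_mono) simp_all

text \<open>A superlevel set of a monotone function is an upper ray, closed or open according to
  whether it contains its infimum.\<close>

lemma primitive_measurable [measurable]: "primitive \<in> borel_measurable borel"
proof (rule borel_measurableI_greater)
  fix y
  show "{x \<in> space borel. y < primitive x} \<in> sets borel"
  proof -
    have up: "y < primitive b" if "y < primitive a" "a \<le> b" for a b
      using that(1) primitive_mono[OF that(2)] by (rule less_le_trans)
    let ?S = "{x. y < primitive x}"
    have "?S = {Inf ?S<..} \<or> ?S = {Inf ?S..}"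
    proof (cases "Inf ?S \<in> ?S")
      case True
      have "?S = {Inf ?S..}"
      proof (intro set_eqI iffI)
        fix x assume "x \<in> ?S"
        then have "Inf ?S \<le> x" by (rule Inf_lower)
        then show "x \<in> {Inf ?S..}" by (rule atLeast_iff[THEN iffD2])
      next
        fix x assume "x \<in> {Inf ?S..}"
        then have "Inf ?S \<le> x" by (rule atLeast_iff[THEN iffD1])
        with True[unfolded mem_Collect_eq] show "x \<in> ?S" by (intro CollectI) (rule up)
      qed
      then show ?thesis by simp
    next
      case False
      have "?S = {Inf ?S<..}"
      proof (intro set_eqI iffI)
        fix x assume "x \<in> ?S"
        then have "Inf ?S \<le> x" "Inf ?S \<noteq> x" using False by (metis Inf_lower)+
        then show "x \<in> {Inf ?S<..}" by (intro greaterThan_iff[THEN iffD2]) (rule order_neq_le_trans)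
      next
        fix x assume "x \<in> {Inf ?S<..}"
        then have "Inf ?S < x" by (rule greaterThan_iff[THEN iffD1])
        then obtain z where "z \<in> ?S" "z < x" unfolding Inf_less_iff by blast
        then show "x \<in> ?S" using up[of z x] by simp
      qed
      then show ?thesis by simp
    qed
    then have "?S \<in> sets borel"
      by (metis (no_types, lifting) borel_open borel_closed open_greaterThan closed_atLeast)
    then show ?thesis by simp
  qed
qed

text \<open>
  By the layer cake formula for \<open>w\<close>, the concave function \<open>W\<close> is a mixture of the functions
  \<open>min x \<tau>\<close>; subadditivity thus reduces to truncated integrals.
\<close>

lemma lorentz_eq_truncated:
  assumes [measurable]: "f \<in> borel_measurable M"
  shows "lorentz f = (\<integral>\<^sup>+y\<in>{0<..}. truncated_integral M (distribution M w y) f \<partial>lborel)"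
proof -
  let ?h = "\<lambda>s y. min (distribution M f s) (distribution M w y) * indicator {0<..} y * indicator {0<..} s"
  have "lorentz f = (\<integral>\<^sup>+s. (\<integral>\<^sup>+y. ?h s y \<partial>lborel) \<partial>lborel)"
    unfolding lorentz_def
    by (intro nn_integral_cong)
      (auto simp: primitive_eq_min[OF distribution_le_I] nn_integral_multc[symmetric])
  also have "\<dots> = (\<integral>\<^sup>+y. (\<integral>\<^sup>+s. ?h s y \<partial>lborel) \<partial>lborel)"
    by (rule lborel_pair.Fubini'[symmetric]) measurable
  also have "\<dots> = (\<integral>\<^sup>+y\<in>{0<..}. truncated_integral M (distribution M w y) f \<partial>lborel)"
    unfolding truncated_integral_def
    by (intro nn_integral_cong) (auto simp: nn_integral_multc[symmetric] indicator_def)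
  finally show ?thesis .
qed

lemma truncated_integral_measurable [measurable]:
  assumes [measurable]: "f \<in> borel_measurable M"
  shows "(\<lambda>y. truncated_integral M (distribution M w y) f) \<in> borel_measurable borel"
  unfolding truncated_integral_def by measurable

lemma lorentz_subadd:
  assumes [measurable]: "f \<in> borel_measurable M" "g \<in> borel_measurable M"
  shows "lorentz (\<lambda>t. f t + g t) \<le> lorentz f + lorentz g"
proof -
  have "lorentz (\<lambda>t. f t + g t) \<le> (\<integral>\<^sup>+y. truncated_integral M (distribution M w y) f * indicator {0<..} y
      + truncated_integral M (distribution M w y) g * indicator {0<..} y \<partial>lborel)"
    using truncated_integral_subadd[OF sigma_finite_M assms]
    by (subst lorentz_eq_truncated) (auto intro!: nn_integral_mono simp: indicator_def)
  also have "\<dots> = lorentz f + lorentz g"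
    by (subst nn_integral_add) (auto simp: lorentz_eq_truncated)
  finally show ?thesis .
qed

lemma lorentz_scale:
  assumes "0 < k" and [measurable]: "f \<in> borel_measurable M"
  shows "lorentz (\<lambda>t. k * f t) = ennreal k * lorentz f"
proof -
  have "lorentz (\<lambda>t. k * f t) = ennreal \<bar>k\<bar> * (\<integral>\<^sup>+s. primitive (distribution M (\<lambda>t. k * f t) (0 + k * s))
      * indicator {0<..} (0 + k * s) \<partial>lborel)"
    unfolding lorentz_def using assms by (intro nn_integral_real_affine) auto
  also have "(\<integral>\<^sup>+s. primitive (distribution M (\<lambda>t. k * f t) (0 + k * s)) * indicator {0<..} (0 + k * s) \<partial>lborel)
      = lorentz f"
    unfolding lorentz_def using assms
    by (intro nn_integral_cong) (auto simp: indicator_def distribution_def abs_mult zero_less_mult_iff)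
  finally show ?thesis using assms by simp
qed

end

subsection \<open>Orlicz functions and the modular\<close>

locale orlicz =
  fixes \<phi> :: "real \<Rightarrow> real"
  assumes orlicz_function: "orlicz_function \<phi>"
begin

lemma phi_convex: "convex_on {0..} \<phi>"
  and phi_nonneg: "0 \<le> u \<Longrightarrow> 0 \<le> \<phi> u"
  and phi_0 [simp]: "\<phi> 0 = 0"
  using orlicz_function by (auto simp: orlicz_function_def)

lemma phi_convex_comb:
  "0 \<le> x \<Longrightarrow> x \<le> 1 \<Longrightarrow> 0 \<le> u \<Longrightarrow> 0 \<le> v \<Longrightarrow> \<phi> (x * u + (1 - x) * v) \<le> x * \<phi> u + (1 - x) * \<phi> v"
  using convex_onD[OF phi_convex, of "1 - x" u v] by simp

lemma phi_shrink: "0 \<le> x \<Longrightarrow> x \<le> 1 \<Longrightarrow> 0 \<le> u \<Longrightarrow> \<phi> (x * u) \<le> x * \<phi> u"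
  using phi_convex_comb[of x u 0] by simp

lemma phi_ratio_mono:
  assumes "0 < u" "u \<le> v"
  shows "\<phi> u / u \<le> \<phi> v / v"
proof -
  have "\<phi> u \<le> u / v * \<phi> v" using phi_shrink[of "u / v" v] assms by simp
  then show ?thesis using assms by (simp add: field_simps)
qed

lemma phi_mono:
  assumes "0 \<le> u" "u \<le> v"
  shows "\<phi> u \<le> \<phi> v"
proof (cases "v = 0")
  case False
  then have "\<phi> u \<le> u / v * \<phi> v" using phi_shrink[of "u / v" v] assms by simp
  also have "\<dots> \<le> 1 * \<phi> v" using assms False by (intro mult_right_mono phi_nonneg) auto
  finally show ?thesis by simp
qed (use assms in auto)

lemma isCont_phi:
  assumes "0 < u"
  shows "isCont \<phi> u"
proof -
  have "continuous_on {0<..} \<phi>"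
    by (intro convex_on_continuous convex_on_subset[OF phi_convex]) auto
  then show ?thesis using assms by (simp add: continuous_on_eq_continuous_at)
qed

lemma phi_unbounded: "\<exists>u>0. y \<le> \<phi> u"
proof -
  obtain v where v: "0 \<le> v" "\<phi> v \<noteq> 0" using orlicz_function by (auto simp: orlicz_function_def)
  then have "0 < v" "0 < \<phi> v" using phi_nonneg[of v] by (auto simp: less_le)
  define u where "u = v * max 1 (y / \<phi> v)"
  have "\<phi> v / v \<le> \<phi> u / u"
    using \<open>0 < v\<close> unfolding u_def by (intro phi_ratio_mono) auto
  then have "u * (\<phi> v / v) \<le> \<phi> u" using \<open>0 < v\<close> by (simp add: u_def field_simps max_def split: if_splits)
  moreover have "u * (\<phi> v / v) \<ge> y"
    using \<open>0 < v\<close> \<open>0 < \<phi> v\<close> by (auto simp: u_def max_def field_simps)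
  ultimately show ?thesis using \<open>0 < v\<close> by (intro exI[of _ u]) (auto simp: u_def)
qed

lemma phi_surj:
  assumes "0 < y"
  obtains u where "0 < u" "\<phi> u = y"
proof -
  obtain v where v: "0 < v" "y \<le> \<phi> v" using phi_unbounded by blast
  \<comment> \<open>Convexity gives continuity on the open half-line only, so the intermediate value
    theorem starts from a positive point \<open>x * v\<close> at which \<phi> is still at most
    y.\<close>
  define x where "x = min 1 (y / \<phi> v)"
  have x: "0 < x" "x \<le> 1" "x * \<phi> v \<le> y"
    using v assms by (auto simp: x_def min_def field_simps)
  have "\<phi> (x * v) \<le> y" using phi_shrink[of x v] v x by linarith
  moreover have "continuous_on {x * v..v} \<phi>"
    using x v by (intro continuous_at_imp_continuous_on ballI isCont_phi)
      (auto intro: less_le_trans[of 0 "x * v"])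
  ultimately obtain u where "x * v \<le> u" "u \<le> v" "\<phi> u = y"
    using v x IVT'[of \<phi> "x * v" y v] by (auto simp: mult_le_cancel_right1)
  moreover have "0 < x * v" using x v by simp
  ultimately show ?thesis using that[of u] by linarith
qed

text \<open>\<phi> may vanish on an initial interval; from the first positive value on, increasing
  chord slopes make it strictly increasing.\<close>

lemma phi_less_iff:
  assumes "0 < \<phi> u" "0 \<le> u" "0 \<le> v"
  shows "\<phi> u < \<phi> v \<longleftrightarrow> u < v"
proof
  assume "u < v"
  moreover have "0 < u" using assms by (cases "u = 0") auto
  ultimately have "\<phi> u / u \<le> \<phi> v / v" by (intro phi_ratio_mono) auto
  then have "\<phi> u * v \<le> \<phi> v * u" using \<open>0 < u\<close> \<open>u < v\<close> by (simp add: field_simps)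
  moreover have "\<phi> u * u < \<phi> u * v" using assms \<open>u < v\<close> by simp
  ultimately have "\<phi> u * u < \<phi> v * u" by linarith
  then show "\<phi> u < \<phi> v" using \<open>0 < u\<close> by simp
next
  assume "\<phi> u < \<phi> v"
  then show "u < v" using phi_mono[of v u] assms by (meson not_le)
qed

lemma phi_abs_measurable [measurable (raw)]:
  assumes "f \<in> borel_measurable N"
  shows "(\<lambda>x. \<phi> \<bar>f x\<bar>) \<in> borel_measurable N"
proof -
  have "(\<lambda>u. \<phi> (max 0 u)) \<in> borel_measurable borel"
    by (intro borel_measurable_mono) (auto simp: mono_def intro!: phi_mono)
  from measurable_compose[OF _ this, of "\<lambda>x. \<bar>f x\<bar>"] assms show ?thesis by simp
qed

text \<open>A supporting line at c. It lies below \<phi> 0 = 0 at the origin and is positive at c,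
  so its slope is positive.\<close>

lemma phi_support:
  assumes "0 < c" "0 < \<phi> c"
  obtains m where "0 < m" "\<And>u. 0 \<le> u \<Longrightarrow> \<phi> c + m * (u - c) \<le> \<phi> u"
proof -
  obtain m where m: "\<phi> c + m * (u - c) \<le> \<phi> u" if "0 \<le> u" for u
    using convex_le_Inf_differential[OF phi_convex, of c] assms by (auto simp: interior_real_atLeast)
  have "\<phi> c \<le> m * c" using m[of 0] by simp
  with assms have "0 < m" by (metis less_le_trans zero_less_mult_pos2)
  with m that show ?thesis by blast
qed

lemma orlicz_ext_mono: "x \<le> y \<Longrightarrow> orlicz_ext \<phi> x \<le> orlicz_ext \<phi> y"
  by (auto simp: orlicz_ext_def top_unique intro!: ennreal_leI phi_mono enn2real_mono simp: less_top)

lemma less_orlicz_ext_iff: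
  assumes "0 < u" "0 < \<phi> u"
  shows "ennreal (\<phi> u) < orlicz_ext \<phi> x \<longleftrightarrow> ennreal u < x"
proof (cases x)
  case (real r)
  then show ?thesis
    using phi_less_iff[of u r] assms by (simp add: orlicz_ext_def ennreal_less_iff)
qed (simp add: orlicz_ext_def)

end

section \<open>Chord and tangent bounds for W and their consequences for the Lorentz
  functional\<close>

context weighted_interval
begin

abbreviation "V \<equiv> weight_primitive w"

lemma weight_primitive_0: "V 0 = 0"
proof -
  have "AE t in lebesgue. indicator {0..0} t *\<^sub>R w t = 0"
    by (rule AE_completion, rule AE_mp[OF AE_lborel_singleton[of 0]]) auto
  then show ?thesis
    unfolding weight_primitive_def set_lebesgue_integral_def by (rule integral_eq_zero_AE)
qed

text \<open>The half-open interval leaves out the point 0 even for x = 0, so monotonicity of w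
  applies on all of it.\<close>

lemma weight_primitive_diff:
  assumes "a \<in> I" "0 \<le> x" "x \<le> a"
  shows "set_integrable lebesgue {x<..a} w" "V a - V x = (LINT t:{x<..a}|lebesgue. w t)"
proof -
  have a: "set_integrable lebesgue {0..a} w" using assms by (intro w_integrable)
  show i: "set_integrable lebesgue {x<..a} w"
    using assms by (intro set_integrable_subset[OF a]) auto
  have "{0..a} = {0..x} \<union> {x<..a}" using assms by auto
  moreover have "(LINT t:{0..x} \<union> {x<..a}|lebesgue. w t)
      = (LINT t:{0..x}|lebesgue. w t) + (LINT t:{x<..a}|lebesgue. w t)"
    using assms i by (intro set_integral_Un set_integrable_subset[OF a]) auto
  ultimately show "V a - V x = (LINT t:{x<..a}|lebesgue. w t)" by (simp add: weight_primitive_def)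
qed

lemma set_integral_const_Ioc:
  "x \<le> a \<Longrightarrow> set_integrable lebesgue {x<..a} (\<lambda>t. k)"
  "x \<le> a \<Longrightarrow> (LINT t:{x<..a}|lebesgue. k) = k * (a - x :: real)" for k :: real
  by (auto simp: set_integrable_def set_lebesgue_integral_def intro!: integrable_real_indicator)

lemma weight_primitive_diff_ge:
  assumes "a \<in> I" "0 \<le> x" "x \<le> a"
  shows "w a * (a - x) \<le> V a - V x"
proof -
  have "w a * (a - x) = (LINT t:{x<..a}|lebesgue. w a)"
    using assms by (simp add: set_integral_const_Ioc)
  also have "\<dots> \<le> V a - V x"
    unfolding weight_primitive_diff(2)[OF assms]
    using assms by (intro set_integral_mono weight_primitive_diff set_integral_const_Ioc w_antimono) auto
  finally show ?thesis .
qed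

lemma weight_primitive_diff_le:
  assumes "a \<in> I" "0 < x" "x \<le> a"
  shows "V a - V x \<le> w x * (a - x)"
proof -
  have *: "0 \<le> x" using assms by simp
  have "V a - V x \<le> (LINT t:{x<..a}|lebesgue. w x)"
    unfolding weight_primitive_diff(2)[OF assms(1) * assms(3)]
    using assms I_down[of a]
    by (intro set_integral_mono weight_primitive_diff set_integral_const_Ioc w_antimono) auto
  also have "\<dots> = w x * (a - x)"
    using assms by (simp add: set_integral_const_Ioc)
  finally show ?thesis .
qed

lemma weight_primitive_ge: "a \<in> I \<Longrightarrow> w a * a \<le> V a"
  using weight_primitive_diff_ge[of a 0] by (simp add: I_iff weight_primitive_0)

lemma weight_primitive_pos: "a \<in> I \<Longrightarrow> 0 < a \<Longrightarrow> 0 < V a"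
  using weight_primitive_ge[of a] w_pos[of a] by (meson less_le_trans mult_pos_pos)

lemma weight_primitive_nonneg: "a \<in> I \<Longrightarrow> 0 \<le> V a"
  using weight_primitive_pos[of a] by (cases "a = 0") (auto simp: weight_primitive_0 I_iff)

text \<open>That is, W(s)/s decreases: beyond x the increment is at most w(x) (s - x), and w(x) is
  at most the average W(x)/x.\<close>

lemma weight_primitive_concave:
  assumes "s \<in> I" "0 \<le> x" "x \<le> s"
  shows "x * V s \<le> s * V x"
proof (cases "x = 0")
  case False
  then have x: "0 < x" "x \<in> I" using assms I_down by auto
  have "x * (V s - V x) \<le> x * (w x * (s - x))"
    using weight_primitive_diff_le[of s x] assms x by (intro mult_left_mono) auto
  also have "\<dots> = (w x * x) * (s - x)" by simp
  also have "\<dots> \<le> V x * (s - x)"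
    using weight_primitive_ge[of x] assms x by (intro mult_right_mono) auto
  finally show ?thesis by (simp add: algebra_simps)
qed (simp add: weight_primitive_0)

lemma primitive_real:
  assumes "a \<in> I"
  shows "primitive (ennreal a) = ennreal (V a)"
proof -
  have "primitive (ennreal a)
      = (\<integral>\<^sup>+t. ennreal (w t) * indicator {t. ennreal t < ennreal a} t * indicator I t \<partial>lebesgue)"
    unfolding primitive_def by (subst nn_integral_restrict_space) auto
  also have "\<dots> = (\<integral>\<^sup>+t. ennreal (indicator {0..a} t *\<^sub>R w t) \<partial>lebesgue)"
  proof (rule nn_integral_cong_AE)
    have "AE t in lebesgue. t \<noteq> a \<and> t \<noteq> 0"
      using AE_lborel_singleton[of a] AE_lborel_singleton[of 0]
      by (intro AE_completion AE_conjI)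
    then show "AE t in lebesgue. ennreal (w t) * indicator {t. ennreal t < ennreal a} t * indicator I t
        = ennreal (indicator {0..a} t *\<^sub>R w t)"
    proof eventually_elim
      case (elim t)
      then show ?case
        using I_down[OF assms, of t] assms by (auto simp: indicator_def ennreal_less_iff I_iff)
    qed
  qed
  also have "\<dots> = ennreal (V a)"
    unfolding weight_primitive_def set_lebesgue_integral_def
  proof (rule nn_integral_eq_integral)
    show "integrable lebesgue (\<lambda>t. indicator {0..a} t *\<^sub>R w t)"
      using w_integrable[OF assms] by (simp add: set_integrable_def)
    have "AE t in lebesgue. t \<noteq> 0" using AE_lborel_singleton[of 0] by (rule AE_completion)
    then show "AE t in lebesgue. 0 \<le> indicator {0..a} t *\<^sub>R w t"
    proof eventually_elim
      case (elim t)
      then show ?case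
        using I_down[OF assms, of t] w_pos[of t] by (auto simp: indicator_def)
    qed
  qed
  finally show ?thesis .
qed

lemma primitive_concave:
  assumes "s \<in> I" "x \<le> ennreal s"
  shows "x * ennreal (V s) \<le> ennreal s * primitive x"
proof -
  obtain r where r: "0 \<le> r" "x = ennreal r" "r \<le> s"
    using assms by (cases x) (auto simp: top_unique I_iff)
  then have "r \<in> I" using I_down assms by blast
  with r assms weight_primitive_concave[of s r] weight_primitive_nonneg show ?thesis
    by (simp add: primitive_real I_iff flip: ennreal_mult)
qed

text \<open>The tangent bound of W at a, arranged without differences because subtraction on
  [0,\<infinity>] is truncated.\<close>

lemma primitive_tangent:
  assumes "a \<in> I" "0 < a" "x \<le> ennreal a"
  shows "primitive x + ennreal (w a * a) \<le> ennreal (V a) + ennreal (w a) * x"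
proof -
  obtain r where r: "0 \<le> r" "x = ennreal r" "r \<le> a"
    using assms by (cases x) (auto simp: top_unique)
  then have "r \<in> I" using I_down assms by blast
  have "V r + w a * a \<le> V a + w a * r"
    using weight_primitive_diff_ge[of a r] r assms by (simp add: algebra_simps)
  then show ?thesis
    using r assms \<open>r \<in> I\<close> w_pos[of a] weight_primitive_nonneg
    by (simp add: primitive_real flip: ennreal_mult ennreal_plus)
qed

lemma Icc_sets_M [measurable]: "a \<in> I \<Longrightarrow> {0..a} \<in> sets M"
  using I_down by (intro sets_M_I) auto

lemma emeasure_Icc: "a \<in> I \<Longrightarrow> emeasure M {0..a} = ennreal a"
  using I_down by (subst emeasure_M) (auto simp: I_iff)

lemma distribution_le_support:
  assumes "E \<in> sets M" "\<And>t. t \<in> I \<Longrightarrow> t \<notin> E \<Longrightarrow> f t = 0" "0 \<le> s"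
  shows "distribution M f s \<le> emeasure M E"
  unfolding distribution_def using assms by (intro emeasure_mono) force+

lemma lorentz_indicator:
  assumes "a \<in> I" "0 \<le> k"
  shows "lorentz (\<lambda>t. k * indicator {0..a} t) = ennreal (k * V a)"
proof -
  have "lorentz (\<lambda>t. k * indicator {0..a} t)
      = (\<integral>\<^sup>+s. ennreal (V a) * indicator {0<..<k} s \<partial>lborel)"
    unfolding lorentz_def
  proof (intro nn_integral_cong, goal_cases)
    case (1 s)
    have *: "{t \<in> space M. s < \<bar>k * indicator {0..a} t\<bar>} = (if s < k then {0..a} else {})" if "0 < s"
      using that assms I_down[OF assms(1)] by (auto simp: indicator_def split: if_splits)
    have "primitive 0 = 0" by (simp add: primitive_def)
    moreover have "distribution M (\<lambda>t. k * indicator {0..a} t) s = (if s < k then ennreal a else 0)"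
      if "0 < s"
      using *[OF that] assms by (cases "s < k") (simp_all only: distribution_def emeasure_Icc emeasure_empty if_True if_False)
    ultimately show ?case
      using assms by (cases "0 < s"; cases "s < k") (simp_all add: primitive_real)
  qed
  also have "\<dots> = ennreal (k * V a)"
    using assms weight_primitive_nonneg by (simp add: nn_integral_cmult mult.commute flip: ennreal_mult)
  finally show ?thesis .
qed

text \<open>After f is cut down to E, all its level sets have measure at most s, where W lies above
  its chord of slope W(s)/s; integrating over the levels compares \<Lambda> with the plain integral.
  It is used with E = [0,a] to bound means, and with E a set of large values to price
  spikes.\<close>

lemma lorentz_ge_on:
  assumes [measurable]: "f \<in> borel_measurable M" "E \<in> sets M" and "emeasure M E \<le> ennreal s" "s \<in> I"
  shows "ennreal (V s) * (\<integral>\<^sup>+t. ennreal \<bar>f t\<bar> * indicator E t \<partial>M) \<le> ennreal s * lorentz f"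
proof -
  define g where "g = (\<lambda>t. f t * indicator E t)"
  have [measurable]: "g \<in> borel_measurable M" unfolding g_def by measurable
  have "ennreal (V s) * (\<integral>\<^sup>+t. ennreal \<bar>f t\<bar> * indicator E t \<partial>M)
      = ennreal (V s) * (\<integral>\<^sup>+t. ennreal \<bar>g t\<bar> \<partial>M)"
    by (intro arg_cong2[where f="(*)"] refl nn_integral_cong) (auto simp: g_def indicator_def)
  also have "\<dots> = (\<integral>\<^sup>+r. ennreal (V s) * (distribution M g r * indicator {0<..} r) \<partial>lborel)"
    by (simp add: layer_cake_abs[OF sigma_finite_M] nn_integral_cmult)
  also have "\<dots> \<le> (\<integral>\<^sup>+r. ennreal s * (primitive (distribution M g r) * indicator {0<..} r) \<partial>lborel)"
  proof (rule nn_integral_mono)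
    fix r
    have "distribution M g r \<le> ennreal s" if "0 < r"
      using distribution_le_support[of E g r] that assms by (auto simp: g_def intro: order_trans)
    then show "ennreal (V s) * (distribution M g r * indicator {0<..} r)
        \<le> ennreal s * (primitive (distribution M g r) * indicator {0<..} r)"
      using primitive_concave[OF \<open>s \<in> I\<close>, of "distribution M g r"]
      by (auto simp: indicator_def mult.commute[of "ennreal (V s)"])
  qed
  also have "\<dots> = ennreal s * lorentz g"
    unfolding lorentz_def by (simp add: nn_integral_cmult)
  also have "\<dots> \<le> ennreal s * lorentz f"
    by (intro mult_left_mono lorentz_mono) (auto simp: g_def indicator_def)
  finally show ?thesis .
qed

text \<open>As r takes values in [0,1], only levels below 1 count, and each level set has measure at
  most a. The tangent bound at a is integrated over these levels, an interval of length one, so its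
  constant terms survive unchanged.\<close>

lemma lorentz_le_tangent:
  assumes "a \<in> I" "0 < a" and [measurable]: "r \<in> borel_measurable M"
    and r: "\<And>t. t \<in> I \<Longrightarrow> 0 \<le> r t" "\<And>t. t \<in> I \<Longrightarrow> r t \<le> 1" "\<And>t. t \<in> I \<Longrightarrow> a < t \<Longrightarrow> r t = 0"
  shows "lorentz r + ennreal (w a * a) \<le> ennreal (V a) + ennreal (w a) * (\<integral>\<^sup>+t. ennreal (r t) \<partial>M)"
proof -
  have D0: "distribution M r s = 0" if "1 \<le> s" for s
  proof -
    have "{t \<in> space M. s < \<bar>r t\<bar>} = {}" using r that by force
    then show ?thesis unfolding distribution_def by (simp only: emeasure_empty)
  qed
  have Da: "distribution M r s \<le> ennreal a" if "0 < s" for s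
    using distribution_le_support[of "{0..a}" r s] assms that r emeasure_Icc[of a]
    by (auto simp: I_iff not_le)
  have one: "(\<integral>\<^sup>+s. k * indicator {0<..<1} (s::real) \<partial>lborel) = k" for k
    by (simp add: nn_integral_cmult)
  have "primitive 0 = 0" by (simp add: primitive_def)
  then have "lorentz r = (\<integral>\<^sup>+s. primitive (distribution M r s) * indicator {0<..<1} s \<partial>lborel)"
    unfolding lorentz_def by (intro nn_integral_cong) (auto simp: indicator_def D0)
  then have "lorentz r + ennreal (w a * a) = (\<integral>\<^sup>+s. primitive (distribution M r s) * indicator {0<..<1} s \<partial>lborel)
      + (\<integral>\<^sup>+s. ennreal (w a * a) * indicator {0<..<1::real} s \<partial>lborel)"
    by (simp only: one)
  also have "\<dots> = (\<integral>\<^sup>+s. primitive (distribution M r s) * indicator {0<..<1} s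
      + ennreal (w a * a) * indicator {0<..<1} s \<partial>lborel)"
    by (rule nn_integral_add[symmetric]) auto
  also have "\<dots> \<le> (\<integral>\<^sup>+s. ennreal (V a) * indicator {0<..<1} s
      + ennreal (w a) * (distribution M r s * indicator {0<..} s) \<partial>lborel)"
    using primitive_tangent[OF assms(1,2) Da] by (intro nn_integral_mono) (auto simp: indicator_def)
  also have "\<dots> = ennreal (V a) + ennreal (w a) * (\<integral>\<^sup>+s\<in>{0<..}. distribution M r s \<partial>lborel)"
    by (subst nn_integral_add) (auto simp: one nn_integral_cmult)
  also have "(\<integral>\<^sup>+s\<in>{0<..}. distribution M r s \<partial>lborel) = (\<integral>\<^sup>+t. ennreal \<bar>r t\<bar> \<partial>M)"
    by (simp add: layer_cake_abs[OF sigma_finite_M])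
  also have "\<dots> = (\<integral>\<^sup>+t. ennreal (r t) \<partial>M)"
    using r by (intro nn_integral_cong) auto
  finally show ?thesis .
qed

end

section \<open>The decreasing rearrangement as generalized inverse of the distribution
  function\<close>

lemma decreasing_rearrangement_antimono:
  "t \<le> u \<Longrightarrow> decreasing_rearrangement N f u \<le> decreasing_rearrangement N f t"
  unfolding decreasing_rearrangement_def
  by (intro Inf_superset_mono) (blast intro: order_trans ennreal_leI)

lemma distribution_right_cont:
  assumes [measurable]: "f \<in> borel_measurable N" and "\<And>s. r < s \<Longrightarrow> distribution N f s \<le> t"
  shows "distribution N f r \<le> t"
proof -
  define A where "A = (\<lambda>n. {x \<in> space N. r + inverse (real (Suc n)) < \<bar>f x\<bar>})"
  have "incseq A"
    unfolding A_def incseq_def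
    by (auto intro: le_less_trans[rotated] le_imp_inverse_le)
  have "{x \<in> space N. r < \<bar>f x\<bar>} = (\<Union>n. A n)"
  proof (intro set_eqI iffI)
    fix x assume "x \<in> {x \<in> space N. r < \<bar>f x\<bar>}"
    then show "x \<in> (\<Union>n. A n)"
      using reals_Archimedean[of "\<bar>f x\<bar> - r"] by (auto simp: A_def algebra_simps)
  qed (auto simp: A_def intro: less_trans[rotated])
  then have "distribution N f r = emeasure N (\<Union>n. A n)" by (simp add: distribution_def)
  also have "\<dots> = (SUP n. emeasure N (A n))"
    using \<open>incseq A\<close> by (intro SUP_emeasure_incseq[symmetric]) (auto simp: A_def)
  also have "\<dots> \<le> t"
    using assms(2) by (intro SUP_least) (auto simp: A_def distribution_def)
  finally show ?thesis .
qed

text \<open>The infimum defining the rearrangement need not come with a level exactly r. It yields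
  the bound on the distribution function at every s > r, and right continuity carries the bound to
  r.\<close>

lemma less_decreasing_rearrangement_iff:
  assumes [measurable]: "f \<in> borel_measurable N" and "0 < r"
  shows "ennreal r < decreasing_rearrangement N f t \<longleftrightarrow> ennreal t < distribution N f r"
proof -
  have "decreasing_rearrangement N f t \<le> ennreal r \<longleftrightarrow> distribution N f r \<le> ennreal t"
  proof
    assume "distribution N f r \<le> ennreal t"
    then show "decreasing_rearrangement N f t \<le> ennreal r"
      unfolding decreasing_rearrangement_def using \<open>0 < r\<close> by (intro Inf_lower) auto
  next
    assume le: "decreasing_rearrangement N f t \<le> ennreal r"
    show "distribution N f r \<le> ennreal t"
    proof (rule distribution_right_cont[OF assms(1)])
      fix s assume "r < s"
      with \<open>0 < r\<close> have "ennreal r < ennreal s" by (simp add: ennreal_less_iff)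
      with le have "decreasing_rearrangement N f t < ennreal s" by (rule le_less_trans)
      then obtain q where q: "0 < q" "distribution N f q \<le> ennreal t" "ennreal q < ennreal s"
        unfolding decreasing_rearrangement_def Inf_less_iff by auto
      then have "q \<le> s" by (simp add: ennreal_less_iff)
      then show "distribution N f s \<le> ennreal t"
        using distribution_antimono[OF assms(1)] q order_trans by blast
    qed
  qed
  then show ?thesis by (meson not_le)
qed

locale orlicz_lorentz_space = weighted_interval \<gamma> w + orlicz \<phi> for \<gamma> w \<phi>
begin

lemma modular_eq_lorentz:
  assumes [measurable]: "f \<in> borel_measurable M"
  shows "modular \<gamma> \<phi> w f = lorentz (\<lambda>t. \<phi> \<bar>f t\<bar>)"
proof -
  define h where "h = (\<lambda>t. orlicz_ext \<phi> (decreasing_rearrangement M f t))"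
  have [measurable]: "h \<in> borel_measurable M"
    unfolding h_def
    by (intro measurable_M borel_measurable_antimono_ennreal)
      (auto simp: antimono_def intro!: orlicz_ext_mono decreasing_rearrangement_antimono)
  have "modular \<gamma> \<phi> w f = (\<integral>\<^sup>+t. h t * ennreal (w t) \<partial>M)"
    by (simp add: modular_def h_def)
  also have "\<dots> = (\<integral>\<^sup>+s\<in>{0<..}. (\<integral>\<^sup>+t. ennreal (w t) * indicator {t. ennreal s < h t} t \<partial>M) \<partial>lborel)"
    by (rule layer_cake[OF sigma_finite_M]) measurable
  also have "\<dots> = lorentz (\<lambda>t. \<phi> \<bar>f t\<bar>)"
    unfolding lorentz_def
  proof (intro nn_integral_cong, goal_cases)
    case (1 s)
    have "(\<integral>\<^sup>+t. ennreal (w t) * indicator {t. ennreal s < h t} t \<partial>M)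
        = primitive (distribution M (\<lambda>t. \<phi> \<bar>f t\<bar>) s)" if pos: "0 < s"
    proof -
      obtain u where u: "0 < u" "\<phi> u = s" using phi_surj[OF pos] by blast
      have "distribution M (\<lambda>t. \<phi> \<bar>f t\<bar>) s = distribution M f u"
        using u pos phi_less_iff[of u] phi_nonneg by (simp add: distribution_def)
      moreover have "ennreal s < h t \<longleftrightarrow> ennreal t < distribution M f u" for t
        using less_orlicz_ext_iff[of u] less_decreasing_rearrangement_iff[OF assms, of u t] u pos
        by (simp add: h_def)
      ultimately show ?thesis by (simp add: primitive_def)
    qed
    then show ?case by (auto simp: indicator_def)
  qed
  finally show ?thesis .
qed

end

subsection \<open>Nearly extremal functions for the Daugavet property\<close>

text \<open>The normalization says that c times the indicator of [0,a] has modular 1.\<close>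

locale normalized_interval = orlicz_lorentz_space +
  fixes a c :: real
  assumes a: "a \<in> interval_I \<gamma>" "0 < a" and c_pos: "0 < c"
    and normalized: "\<phi> c * weight_primitive w a = 1"
begin

lemma initial_subset: "{0..a} \<subseteq> I"
  using I_down a by auto

lemma initial_sets [measurable]: "{0..a} \<in> sets M"
  using a by simp

lemma phi_c_pos: "0 < \<phi> c"
  using normalized phi_nonneg[of c] c_pos by (auto simp: less_le)

lemma V_a_pos: "0 < V a"
  using weight_primitive_pos a by simp

lemma V_a: "V a = 1 / \<phi> c"
  using normalized phi_c_pos by (simp add: field_simps)

lemma nn_integral_indicator_Icc [simp]: "(\<integral>\<^sup>+t. k * indicator {0..a} t \<partial>M) = k * ennreal a"
  using a by (simp add: nn_integral_cmult emeasure_Icc)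

text \<open>Jensen's inequality: the concavity bound on [0,a] shows that \<phi>|f| has average at
  most 1 / W(a) = \<phi> c there, and the supporting line at c turns this into an average of |f| of
  at most c.\<close>

lemma nn_integral_Icc_le:
  assumes [measurable]: "f \<in> borel_measurable M" and F: "lorentz (\<lambda>t. \<phi> \<bar>f t\<bar>) \<le> 1"
  shows "(\<integral>\<^sup>+t. ennreal \<bar>f t\<bar> * indicator {0..a} t \<partial>M) \<le> ennreal (c * a)"
proof -
  let ?X = "\<integral>\<^sup>+t. ennreal \<bar>f t\<bar> * indicator {0..a} t \<partial>M"
  let ?Y = "\<integral>\<^sup>+t. ennreal (\<phi> \<bar>f t\<bar>) * indicator {0..a} t \<partial>M"
  obtain m where m: "0 < m" "\<And>u. 0 \<le> u \<Longrightarrow> \<phi> c + m * (u - c) \<le> \<phi> u"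
    using phi_support[OF c_pos phi_c_pos] by blast
  have mc: "\<phi> c \<le> m * c" using m(2)[of 0] by simp
  have "ennreal (V a) * (\<integral>\<^sup>+t. ennreal \<bar>\<phi> \<bar>f t\<bar>\<bar> * indicator {0..a} t \<partial>M)
      \<le> ennreal a * lorentz (\<lambda>t. \<phi> \<bar>f t\<bar>)"
    using a by (intro lorentz_ge_on) (auto simp: emeasure_Icc)
  also have "\<dots> \<le> ennreal a" using mult_left_mono[OF F, of "ennreal a"] by simp
  finally have "ennreal (V a) * ?Y \<le> ennreal a" by (simp add: phi_nonneg)
  then have "ennreal (\<phi> c) * (ennreal (V a) * ?Y) \<le> ennreal (\<phi> c) * ennreal a"
    by (rule mult_left_mono) simp
  moreover have "ennreal (\<phi> c) * ennreal (V a) = 1"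
    using normalized phi_c_pos V_a_pos by (simp flip: ennreal_mult)
  ultimately have Y: "?Y \<le> ennreal (\<phi> c * a)"
    using phi_c_pos a by (simp add: ennreal_mult mult.assoc[symmetric])
  have "ennreal m * ?X = (\<integral>\<^sup>+t. ennreal (m * \<bar>f t\<bar>) * indicator {0..a} t \<partial>M)"
    using m by (simp add: nn_integral_cmult[symmetric] ennreal_mult mult.assoc)
  also have "\<dots> \<le> (\<integral>\<^sup>+t. ennreal (\<phi> \<bar>f t\<bar>) * indicator {0..a} t
      + ennreal (m * c - \<phi> c) * indicator {0..a} t \<partial>M)"
  proof (intro nn_integral_mono)
    fix t
    have "ennreal (m * \<bar>f t\<bar>) \<le> ennreal (\<phi> \<bar>f t\<bar> + (m * c - \<phi> c))"
      using m(2)[of "\<bar>f t\<bar>"] by (intro ennreal_leI) (simp add: algebra_simps)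
    also have "\<dots> = ennreal (\<phi> \<bar>f t\<bar>) + ennreal (m * c - \<phi> c)"
      using mc phi_nonneg by (intro ennreal_plus) auto
    finally show "ennreal (m * \<bar>f t\<bar>) * indicator {0..a} t \<le> ennreal (\<phi> \<bar>f t\<bar>) * indicator {0..a} t
      + ennreal (m * c - \<phi> c) * indicator {0..a} t" by (auto simp: indicator_def)
  qed
  also have "\<dots> = ?Y + ennreal (m * c - \<phi> c) * ennreal a"
    using a by (subst nn_integral_add) auto
  also have "\<dots> \<le> ennreal (\<phi> c * a) + ennreal (m * c - \<phi> c) * ennreal a"
    using Y by (rule add_right_mono)
  also have "\<dots> = ennreal (m * (c * a))"
    using mc a phi_c_pos by (simp add: algebra_simps flip: ennreal_mult ennreal_plus)
  finally have "ennreal (1 / m) * (ennreal m * ?X) \<le> ennreal (1 / m) * ennreal (m * (c * a))"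
    by (rule mult_left_mono) simp
  then show ?thesis
    using m c_pos a by (simp add: mult.assoc[symmetric] flip: ennreal_mult)
qed

definition mean :: "(real \<Rightarrow> real) \<Rightarrow> real" where
  "mean f = (LINT t|M. f t * indicator {0..a} t) / a"

lemma integrable_if_lorentz_le:
  assumes [measurable]: "f \<in> borel_measurable M" and F: "lorentz (\<lambda>t. \<phi> \<bar>f t\<bar>) \<le> 1"
  shows "integrable M (\<lambda>t. f t * indicator {0..a} t)"
proof (rule integrableI_bounded)
  have "(\<integral>\<^sup>+t. ennreal (norm (f t * indicator {0..a} t)) \<partial>M) = (\<integral>\<^sup>+t. ennreal \<bar>f t\<bar> * indicator {0..a} t \<partial>M)"
    by (intro nn_integral_cong) (auto simp: indicator_def)
  also have "\<dots> < \<infinity>" using nn_integral_Icc_le[OF assms] by (auto intro: le_less_trans)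
  finally show "(\<integral>\<^sup>+t. ennreal (norm (f t * indicator {0..a} t)) \<partial>M) < \<infinity>" .
qed (use a in measurable)

lemma abs_mean_le:
  assumes [measurable]: "f \<in> borel_measurable M" and F: "lorentz (\<lambda>t. \<phi> \<bar>f t\<bar>) \<le> 1"
  shows "\<bar>mean f\<bar> \<le> c"
proof -
  have "ennreal \<bar>LINT t|M. f t * indicator {0..a} t\<bar> \<le> (\<integral>\<^sup>+t. ennreal (norm (f t * indicator {0..a} t)) \<partial>M)"
    using integral_norm_bound_ennreal[OF integrable_if_lorentz_le[OF assms]] by simp
  also have "\<dots> = (\<integral>\<^sup>+t. ennreal \<bar>f t\<bar> * indicator {0..a} t \<partial>M)"
    by (intro nn_integral_cong) (auto simp: indicator_def)
  also have "\<dots> \<le> ennreal (c * a)" by (rule nn_integral_Icc_le[OF assms])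
  finally have "\<bar>LINT t|M. f t * indicator {0..a} t\<bar> \<le> c * a"
    using c_pos a by simp
  then show ?thesis using a by (simp add: mean_def abs_divide field_simps)
qed

text \<open>Since \<Lambda> is homogeneous and subadditive, 1 < (1 + k R) / (2 - \<epsilon>). It is
  applied once with r the full indicator, which bounds the mean, and once with a smaller r, which
  bounds the part of f below level c.\<close>

lemma lorentz_average_bound:
  assumes [measurable]: "f \<in> borel_measurable M" "r \<in> borel_measurable M"
    and F: "lorentz (\<lambda>t. \<phi> \<bar>f t\<bar>) \<le> 1" and "0 < \<epsilon>" "\<epsilon> < 1" "0 < k"
    and G: "1 < lorentz g"
    and le: "\<And>t. t \<in> I \<Longrightarrow> 0 \<le> g t \<and> g t \<le> (\<phi> \<bar>f t\<bar> + k * r t) / (2 - \<epsilon>)"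
    and r: "lorentz r \<le> ennreal R" "0 \<le> R"
  shows "1 - \<epsilon> < k * R"
proof -
  have "lorentz g \<le> lorentz (\<lambda>t. 1 / (2 - \<epsilon>) * (\<phi> \<bar>f t\<bar> + k * r t))"
  proof (rule lorentz_mono)
    show "\<bar>g t\<bar> \<le> \<bar>1 / (2 - \<epsilon>) * (\<phi> \<bar>f t\<bar> + k * r t)\<bar>" if "t \<in> I" for t
      using le[OF that] abs_ge_self[of "1 / (2 - \<epsilon>) * (\<phi> \<bar>f t\<bar> + k * r t)"] by simp
  qed measurable
  also have "\<dots> = ennreal (1 / (2 - \<epsilon>)) * lorentz (\<lambda>t. \<phi> \<bar>f t\<bar> + k * r t)"
    using assms by (intro lorentz_scale) auto
  also have "\<dots> \<le> ennreal (1 / (2 - \<epsilon>)) * (ennreal 1 + ennreal k * ennreal R)"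
  proof (rule mult_left_mono)
    have "lorentz (\<lambda>t. \<phi> \<bar>f t\<bar> + k * r t) \<le> lorentz (\<lambda>t. \<phi> \<bar>f t\<bar>) + lorentz (\<lambda>t. k * r t)"
      by (rule lorentz_subadd) measurable
    also have "lorentz (\<lambda>t. k * r t) = ennreal k * lorentz r"
      using assms by (intro lorentz_scale) auto
    also have "lorentz (\<lambda>t. \<phi> \<bar>f t\<bar>) + ennreal k * lorentz r \<le> ennreal 1 + ennreal k * ennreal R"
      using F r by (intro add_mono mult_left_mono) auto
    finally show "lorentz (\<lambda>t. \<phi> \<bar>f t\<bar> + k * r t) \<le> ennreal 1 + ennreal k * ennreal R" .
  qed simp
  also have "\<dots> = ennreal ((1 + k * R) / (2 - \<epsilon>))"
    using assms by (simp flip: ennreal_mult ennreal_plus ennreal_1)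
  finally have "ennreal 1 < ennreal ((1 + k * R) / (2 - \<epsilon>))"
    using G by (simp only: ennreal_1 less_le_trans)
  then have "1 < (1 + k * R) / (2 - \<epsilon>)" by (subst (asm) ennreal_less_iff) simp_all
  then show ?thesis using assms by (simp add: field_simps)
qed

text \<open>The modular form of: f lies in the unit ball and identity plus averaging operator sends
  it to norm above 2 - \<epsilon>. The sign of f is normalized by
  \<open>0 \<le> mean f\<close>.\<close>

definition near_extremal :: "real \<Rightarrow> (real \<Rightarrow> real) \<Rightarrow> bool" where
  "near_extremal \<epsilon> f \<longleftrightarrow> f \<in> borel_measurable M \<and> modular \<gamma> \<phi> w f \<le> 1 \<and> 0 \<le> mean f \<and>
     1 < modular \<gamma> \<phi> w (\<lambda>t. (f t - mean f * indicator {0..a} t) / (2 - \<epsilon>))"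

text \<open>Division by c makes this a [0,1]-valued function that equals 1 where f \<ge> c on [0,a];
  its integral therefore bounds the measure of {f \<ge> u} in [0,a] for every u \<ge> c.\<close>

definition clipped :: "(real \<Rightarrow> real) \<Rightarrow> real \<Rightarrow> real" where
  "clipped f t = min (max 0 (f t)) c / c * indicator {0..a} t"

lemma clipped_measurable [measurable]:
  assumes [measurable]: "f \<in> borel_measurable M"
  shows "clipped f \<in> borel_measurable M"
  unfolding clipped_def[abs_def] by measurable

lemma clipped_bounds: "0 \<le> clipped f t" "clipped f t \<le> indicator {0..a} t"
  using c_pos by (auto simp: clipped_def indicator_def)

lemma integrable_indicator_Icc: "integrable M (indicator {0..a} :: real \<Rightarrow> real)"
  using a by (intro integrable_real_indicator) (auto simp: emeasure_Icc)

lemma integrable_clipped: "f \<in> borel_measurable M \<Longrightarrow> integrable M (clipped f)"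
  by (rule Bochner_Integration.integrable_bound[OF integrable_indicator_Icc])
    (use clipped_bounds[of f] in auto)

lemma near_extremal_bounds:
  assumes "near_extremal \<epsilon> f" and \<epsilon>: "0 < \<epsilon>" "\<epsilon> < 1"
  shows "(1 - \<epsilon>) * c < mean f"
    and "w a * (LINT t|M. clipped f t) < 1 / \<phi> c - 1 / \<phi> (c / (1 - \<epsilon>))"
proof -
  define \<alpha> where "\<alpha> = mean f"
  define g where "g = (\<lambda>t. \<phi> \<bar>(f t - \<alpha> * indicator {0..a} t) / (2 - \<epsilon>)\<bar>)"
  have [measurable]: "f \<in> borel_measurable M" and "0 \<le> \<alpha>"
    using assms by (auto simp: near_extremal_def \<alpha>_def)
  have F: "lorentz (\<lambda>t. \<phi> \<bar>f t\<bar>) \<le> 1"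
    using assms by (auto simp: near_extremal_def modular_eq_lorentz)
  have G: "1 < lorentz g"
    using assms(1) unfolding near_extremal_def g_def
    by (subst (asm) (2) modular_eq_lorentz) (auto simp: \<alpha>_def)
  have g_nonneg: "0 \<le> g t" for t by (simp add: g_def phi_nonneg)
  have "\<alpha> \<le> c" using abs_mean_le[OF _ F] by (simp add: \<alpha>_def)
  have "c \<le> c / (1 - \<epsilon>)" using c_pos \<epsilon> by (simp add: field_simps)
  then have "0 < \<phi> (c / (1 - \<epsilon>))" using phi_c_pos phi_mono[of c "c / (1 - \<epsilon>)"] c_pos by linarith
  \<comment> \<open>As 2 - \<epsilon> = 1 + (1 - \<epsilon>), division by 2 - \<epsilon> averages
    |f| and \<alpha> / (1 - \<epsilon>) times the indicator with weights x and 1 - x.\<close>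
  define x where "x = 1 / (2 - \<epsilon>)"
  have x: "0 < x" "x \<le> 1" "1 - x = (1 - \<epsilon>) / (2 - \<epsilon>)" using \<epsilon> by (auto simp: x_def field_simps)
  have comb: "g t \<le> (\<phi> \<bar>f t\<bar> + (1 - \<epsilon>) * \<phi> (\<alpha> / (1 - \<epsilon>)) * indicator {0..a} t) / (2 - \<epsilon>)" for t
  proof -
    let ?b = "\<alpha> / (1 - \<epsilon>) * indicator {0..a} t"
    have "\<bar>(f t - \<alpha> * indicator {0..a} t) / (2 - \<epsilon>)\<bar> \<le> x * \<bar>f t\<bar> + (1 - x) * ?b"
    proof -
      have "(1 - x) * ?b = x * \<bar>\<alpha> * indicator {0..a} t\<bar>"
        using \<epsilon> \<open>0 \<le> \<alpha>\<close> unfolding x(3) by (simp add: x_def)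
      moreover have "\<bar>(f t - \<alpha> * indicator {0..a} t) / (2 - \<epsilon>)\<bar> = x * \<bar>f t - \<alpha> * indicator {0..a} t\<bar>"
        using \<epsilon> by (simp add: x_def abs_divide)
      ultimately show ?thesis
        using x abs_triangle_ineq4[of "f t" "\<alpha> * indicator {0..a} t"]
        by (simp add: mult_left_mono flip: distrib_left)
    qed
    then have "g t \<le> \<phi> (x * \<bar>f t\<bar> + (1 - x) * ?b)" unfolding g_def by (intro phi_mono) auto
    also have "\<dots> \<le> x * \<phi> \<bar>f t\<bar> + (1 - x) * \<phi> ?b"
      using x \<epsilon> \<open>0 \<le> \<alpha>\<close> by (intro phi_convex_comb) (auto simp: indicator_def)
    also have "\<dots> = (\<phi> \<bar>f t\<bar> + (1 - \<epsilon>) * \<phi> (\<alpha> / (1 - \<epsilon>)) * indicator {0..a} t) / (2 - \<epsilon>)"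
      unfolding x(3) by (cases "t \<in> {0..a}") (simp_all add: x_def add_divide_distrib)
    finally show ?thesis .
  qed
  show *: "(1 - \<epsilon>) * c < mean f"
  proof (rule ccontr)
    \<comment> \<open>In this case \<alpha> / (1 - \<epsilon>) \<le> c, so the added term has
      \<Lambda> at most (1 - \<epsilon>) \<phi>(c) W(a) = 1 - \<epsilon>, which leaves no room for
      the strict inequality.\<close>
    assume "\<not> (1 - \<epsilon>) * c < mean f"
    then have "\<alpha> / (1 - \<epsilon>) \<le> c" using \<epsilon> by (simp add: \<alpha>_def field_simps)
    then have "\<phi> (\<alpha> / (1 - \<epsilon>)) \<le> \<phi> c" using \<epsilon> \<open>0 \<le> \<alpha>\<close> by (intro phi_mono) auto
    then have le: "g t \<le> (\<phi> \<bar>f t\<bar> + (1 - \<epsilon>) * \<phi> c * indicator {0..a} t) / (2 - \<epsilon>)" for t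
      using \<epsilon> by (intro order_trans[OF comb] divide_right_mono add_left_mono mult_right_mono mult_left_mono) auto
    have "lorentz (indicator {0..a}) \<le> ennreal (V a)"
      using lorentz_indicator[of a 1] a by simp
    from lorentz_average_bound[OF _ _ F \<epsilon> _ G _ this, of "(1 - \<epsilon>) * \<phi> c"] le g_nonneg V_a_pos phi_c_pos \<epsilon>
    have "1 - \<epsilon> < (1 - \<epsilon>) * \<phi> c * V a" by auto
    then show False using normalized by (simp add: mult.assoc)
  qed
  \<comment> \<open>K dominates the coefficient in \<open>comb\<close> because \<alpha> \<le> c, and
    it dominates \<phi> c by convexity; the two bounds serve different cases below.\<close>
  define K where "K = (1 - \<epsilon>) * \<phi> (c / (1 - \<epsilon>))"
  have K: "\<phi> c \<le> K" "(1 - \<epsilon>) * \<phi> (\<alpha> / (1 - \<epsilon>)) \<le> K"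
  proof -
    show "\<phi> c \<le> K" using phi_shrink[of "1 - \<epsilon>" "c / (1 - \<epsilon>)"] \<epsilon> c_pos by (simp add: K_def)
    show "(1 - \<epsilon>) * \<phi> (\<alpha> / (1 - \<epsilon>)) \<le> K"
      unfolding K_def using \<epsilon> \<open>\<alpha> \<le> c\<close> \<open>0 \<le> \<alpha>\<close>
      by (intro mult_left_mono phi_mono divide_right_mono) auto
  qed
  define r where "r = (\<lambda>t. indicator {0..a} t - clipped f t)"
  have [measurable]: "r \<in> borel_measurable M" unfolding r_def by measurable
  have r: "0 \<le> r t" "r t \<le> 1" "a < t \<Longrightarrow> r t = 0" for t
    using clipped_bounds[of f t] by (auto simp: r_def indicator_def clipped_def split: if_splits)
  \<comment> \<open>The gain over \<open>comb\<close> comes from cancellation. Where f \<ge>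
    \<alpha> nothing need be added to \<phi>|f|; where 0 \<le> f < \<alpha> the remainder \<alpha> -
    f is at most (1 - f/c) c, and convexity yields the factor r t = 1 - f/c.\<close>
  have le: "g t \<le> (\<phi> \<bar>f t\<bar> + K * r t) / (2 - \<epsilon>)" if "t \<in> I" for t
  proof -
    consider "t \<notin> {0..a} \<or> f t < 0" | "t \<in> {0..a}" "\<alpha> \<le> f t" | "t \<in> {0..a}" "0 \<le> f t" "f t < \<alpha>"
      by linarith
    then show ?thesis
    proof cases
      case 1
      then have "r t = indicator {0..a} t" using c_pos by (auto simp: r_def clipped_def)
      moreover have "(\<phi> \<bar>f t\<bar> + (1 - \<epsilon>) * \<phi> (\<alpha> / (1 - \<epsilon>)) * indicator {0..a} t) / (2 - \<epsilon>)
          \<le> (\<phi> \<bar>f t\<bar> + K * indicator {0..a} t) / (2 - \<epsilon>)"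
        using K(2) \<epsilon> by (intro divide_right_mono add_left_mono mult_right_mono) simp_all
      ultimately show ?thesis using comb[of t] by simp
    next
      case 2
      have "g t \<le> \<phi> (x * f t)"
        unfolding g_def using 2 \<epsilon> \<open>0 \<le> \<alpha>\<close> by (intro phi_mono) (auto simp: x_def divide_right_mono)
      also have "\<dots> \<le> x * \<phi> (f t)" using x 2 \<open>0 \<le> \<alpha>\<close> by (intro phi_shrink) auto
      also have "\<dots> \<le> (\<phi> \<bar>f t\<bar> + K * r t) / (2 - \<epsilon>)"
        using 2 \<open>0 \<le> \<alpha>\<close> r[of t] K phi_c_pos \<epsilon> by (auto simp: x_def intro!: divide_right_mono)
      finally show ?thesis .
    next
      case 3
      have "g t = \<phi> (x * (\<alpha> - f t))"
        unfolding g_def using 3 \<epsilon> by (simp add: x_def abs_divide)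
      also have "\<dots> \<le> x * \<phi> (\<alpha> - f t)" using x 3 by (intro phi_shrink) auto
      also have "\<dots> \<le> x * \<phi> ((1 - f t / c) * c)"
        using x 3 \<open>\<alpha> \<le> c\<close> c_pos by (intro mult_left_mono phi_mono) (auto simp: field_simps)
      also have "\<dots> \<le> x * ((1 - f t / c) * \<phi> c)"
        using x 3 \<open>\<alpha> \<le> c\<close> c_pos by (intro mult_left_mono phi_shrink) (auto simp: field_simps)
      also have "1 - f t / c = r t"
        using 3 \<open>\<alpha> \<le> c\<close> c_pos by (simp add: r_def clipped_def)
      also have "x * (r t * \<phi> c) \<le> x * (\<phi> \<bar>f t\<bar> + K * r t)"
      proof (intro mult_left_mono)
        have "r t * \<phi> c \<le> r t * K" using K r by (intro mult_left_mono) auto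
        then show "r t * \<phi> c \<le> \<phi> \<bar>f t\<bar> + K * r t" using phi_nonneg[of "\<bar>f t\<bar>"] by (simp add: mult.commute)
      qed (use x in simp)
      finally show ?thesis by (simp add: x_def)
    qed
  qed
  let ?Q = "LINT t|M. clipped f t"
  have int_r: "integrable M r" "(LINT t|M. r t) = a - ?Q"
    using integrable_clipped[of f] integrable_indicator_Icc a
    by (auto simp: r_def measure_def emeasure_Icc Int_absorb2 initial_subset)
  have "(\<integral>\<^sup>+t. ennreal (r t) \<partial>M) = ennreal (a - ?Q)"
    using int_r r by (subst nn_integral_eq_integral) auto
  then have "lorentz r + ennreal (w a * a) \<le> ennreal (V a) + ennreal (w a) * ennreal (a - ?Q)"
    using lorentz_le_tangent[of a r] a r by simp
  also have "\<dots> = ennreal (V a + w a * (a - ?Q))"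
  proof -
    have "0 \<le> a - ?Q" using int_r r Bochner_Integration.integral_nonneg[of M r] by simp
    then show ?thesis using w_pos[of a] a V_a_pos by (simp flip: ennreal_mult ennreal_plus)
  qed
  finally have tangent: "lorentz r + ennreal (w a * a) \<le> ennreal (V a + w a * (a - ?Q))" .
  then have "lorentz r \<noteq> \<infinity>" by (auto simp: top_unique)
  then obtain R where R: "0 \<le> R" "lorentz r = ennreal R" by (cases "lorentz r") auto
  have "R + w a * a \<le> V a + w a * (a - ?Q)"
  proof -
    have "ennreal (R + w a * a) \<le> ennreal (V a + w a * (a - ?Q))"
      using tangent R w_pos[of a] a by simp
    moreover have "0 < R + w a * a" using R w_pos[of a] a by (simp add: add_nonneg_pos)
    ultimately show ?thesis by (auto simp: ennreal_le_iff2)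
  qed
  then have "R \<le> V a - w a * ?Q" by (simp add: algebra_simps)
  moreover have "0 < K" using K phi_c_pos by linarith
  moreover have "1 - \<epsilon> < K * R"
    using lorentz_average_bound[OF _ _ F \<epsilon> \<open>0 < K\<close> G _ _ R(1), of r] le g_nonneg R by auto
  ultimately have "1 - \<epsilon> < K * (V a - w a * ?Q)"
    by (meson less_le_trans mult_left_mono less_imp_le)
  then have "1 < \<phi> (c / (1 - \<epsilon>)) * (1 / \<phi> c - w a * ?Q)"
    using \<epsilon> by (simp add: K_def V_a mult.assoc)
  then show "w a * ?Q < 1 / \<phi> c - 1 / \<phi> (c / (1 - \<epsilon>))"
    using \<open>0 < \<phi> (c / (1 - \<epsilon>))\<close> by (simp add: field_simps)
qed

text \<open>Outside E = {f \<ge> u}, f is at most u times its clipped version on [0,a], so E carries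
  integral at least a mean f - u Q, with Q the clipped integral. There \<phi>(f) \<ge> (\<phi>(u)/u)
  f, and E has measure at most Q \<le> s, so the chord bound for W at s prices this mass.\<close>

lemma concentration:
  assumes [measurable]: "f \<in> borel_measurable M" and F: "lorentz (\<lambda>t. \<phi> \<bar>f t\<bar>) \<le> 1"
    and s: "s \<in> I" "(LINT t|M. clipped f t) \<le> s" and u: "c \<le> u"
  shows "V s * (\<phi> u / u) * (a * mean f - u * (LINT t|M. clipped f t)) \<le> s"
proof -
  let ?Q = "LINT t|M. clipped f t"
  define E where "E = {t \<in> I. t \<in> {0..a} \<and> u \<le> f t}"
  have "{t \<in> space M. t \<in> {0..a} \<and> u \<le> f t} \<in> sets M" by measurable
  then have [measurable]: "E \<in> sets M" by (simp add: E_def)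
  have "0 < u" using u c_pos by simp
  have "emeasure M E = (\<integral>\<^sup>+t. indicator E t \<partial>M)" by simp
  also have "\<dots> \<le> (\<integral>\<^sup>+t. ennreal (clipped f t) \<partial>M)"
    using u c_pos by (intro nn_integral_mono) (auto simp: indicator_def clipped_def E_def)
  also have "\<dots> = ennreal ?Q"
    using clipped_bounds by (intro nn_integral_eq_integral integrable_clipped) auto
  finally have "emeasure M E \<le> ennreal s" using s by (meson ennreal_leI order_trans)
  then have "ennreal (V s) * (\<integral>\<^sup>+t. ennreal \<bar>\<phi> \<bar>f t\<bar>\<bar> * indicator E t \<partial>M) \<le> ennreal s * lorentz (\<lambda>t. \<phi> \<bar>f t\<bar>)"
    using s by (intro lorentz_ge_on) auto
  also have "\<dots> \<le> ennreal s" using mult_left_mono[OF F, of "ennreal s"] by simp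
  finally have upper: "ennreal (V s) * (\<integral>\<^sup>+t. ennreal \<bar>\<phi> \<bar>f t\<bar>\<bar> * indicator E t \<partial>M) \<le> ennreal s" .
  have int_E: "integrable M (\<lambda>t. f t * indicator E t)"
  proof (rule Bochner_Integration.integrable_bound[OF integrable_if_lorentz_le[OF _ F]])
    show "AE t in M. norm (f t * indicator E t) \<le> norm (f t * indicator {0..a} t)"
      by (auto simp: E_def indicator_def)
  qed measurable
  have "a * mean f = (LINT t|M. f t * indicator {0..a} t)" using a by (simp add: mean_def)
  also have "\<dots> \<le> (LINT t|M. f t * indicator E t + u * clipped f t)"
  proof (intro integral_mono integrable_if_lorentz_le F Bochner_Integration.integrable_add int_E
      integrable_mult_right integrable_clipped)
    fix t assume "t \<in> space M"
    then have "t \<in> I" by simp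
    \<comment> \<open>For 0 < f \<le> c the right side is (u/c) f with u/c \<ge> 1; for c < f < u
      the clipped factor is 1.\<close>
    have "f t \<le> u * (min (max 0 (f t)) c / c)" if "f t < u"
    proof (cases "f t \<le> c")
      case True
      have "max 0 (f t) * c \<le> u * max 0 (f t)" using u by (simp add: mult.commute mult_right_mono)
      moreover have "f t * c \<le> max 0 (f t) * c" using c_pos by (intro mult_right_mono) auto
      ultimately have "f t * c \<le> u * max 0 (f t)" by linarith
      then show ?thesis using True c_pos by (simp add: field_simps)
    qed (use that c_pos in auto)
    then show "f t * indicator {0..a} t \<le> f t * indicator E t + u * clipped f t"
      using \<open>t \<in> I\<close> \<open>0 < u\<close> c_pos by (auto simp: E_def clipped_def indicator_def not_le)
  qed measurable
  also have "\<dots> = (LINT t|M. f t * indicator E t) + u * ?Q"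
    using int_E integrable_clipped[of f] by simp
  finally have "a * mean f - u * ?Q \<le> (LINT t|M. f t * indicator E t)" by simp
  then have "ennreal (\<phi> u / u) * ennreal (a * mean f - u * ?Q)
      \<le> ennreal (\<phi> u / u) * (\<integral>\<^sup>+t. ennreal (f t * indicator E t) \<partial>M)"
    using \<open>0 < u\<close> int_E
    by (subst nn_integral_eq_integral) (auto intro!: mult_left_mono ennreal_leI simp: E_def indicator_def)
  also have "\<dots> = (\<integral>\<^sup>+t. ennreal (\<phi> u / u) * ennreal (f t * indicator E t) \<partial>M)"
    by (rule nn_integral_cmult[symmetric]) measurable
  also have "\<dots> \<le> (\<integral>\<^sup>+t. ennreal \<bar>\<phi> \<bar>f t\<bar>\<bar> * indicator E t \<partial>M)"
  proof (intro nn_integral_mono)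
    fix t
    have "\<phi> u / u * f t \<le> \<phi> (f t)" if "u \<le> f t"
      using phi_ratio_mono[OF \<open>0 < u\<close> that] \<open>0 < u\<close> that by (simp add: field_simps)
    then show "ennreal (\<phi> u / u) * ennreal (f t * indicator E t) \<le> ennreal \<bar>\<phi> \<bar>f t\<bar>\<bar> * indicator E t"
      using \<open>0 < u\<close> phi_nonneg[of u] phi_nonneg[of "f t"]
      by (auto simp: E_def indicator_def simp flip: ennreal_mult intro!: ennreal_leI)
  qed
  finally have *: "ennreal (V s) * (ennreal (\<phi> u / u) * ennreal (a * mean f - u * ?Q)) \<le> ennreal s"
    by (rule order_trans[OF mult_left_mono upper]) simp
  have "0 \<le> V s" "0 \<le> \<phi> u / u" "0 \<le> s"
    using weight_primitive_nonneg s phi_nonneg[of u] \<open>0 < u\<close> by (auto simp: I_iff)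
  show ?thesis
  \<comment> \<open>A negative factor is lost under \<open>ennreal\<close>, but then the claim is
    trivial.\<close>
  proof (cases "0 \<le> a * mean f - u * ?Q")
    case True
    with \<open>0 \<le> V s\<close> \<open>0 \<le> \<phi> u / u\<close>
    have "ennreal (V s) * (ennreal (\<phi> u / u) * ennreal (a * mean f - u * ?Q))
        = ennreal (V s * (\<phi> u / u) * (a * mean f - u * ?Q))"
      by (simp only: ennreal_mult[symmetric] mult_nonneg_nonneg mult.assoc)
    with * \<open>0 \<le> s\<close> show ?thesis by simp
  next
    case False
    then have "V s * (\<phi> u / u) * (a * mean f - u * ?Q) \<le> 0"
      using mult_nonneg_nonneg[OF \<open>0 \<le> V s\<close> \<open>0 \<le> \<phi> u / u\<close>] by (intro mult_nonneg_nonpos) simp_all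
    with \<open>0 \<le> s\<close> show ?thesis by linarith
  qed
qed

text \<open>The clipped integral is eventually below any fixed s > 0, so
  \<open>concentration\<close> applies with s and u held fixed while \<epsilon> tends to 0; the mean
  tends to c and the clipped term disappears.\<close>

lemma extremal_slopes:
  assumes ex: "\<And>\<epsilon>. 0 < \<epsilon> \<Longrightarrow> \<epsilon> < 1 \<Longrightarrow> \<exists>f. near_extremal \<epsilon> f"
    and s: "s \<in> I" "0 < s" and u: "c \<le> u"
  shows "V s / s * (\<phi> u / u) \<le> V a / a * (\<phi> c / c)"
proof -
  \<comment> \<open>The bound on the clipped integral from \<open>near_extremal_bounds\<close>; it
    vanishes in the limit by continuity of \<phi> at c.\<close>
  define \<delta> where "\<delta> = (\<lambda>\<epsilon>. (1 / \<phi> c - 1 / \<phi> (c / (1 - \<epsilon>))) / w a)"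
  have "0 < w a" using w_pos a by simp
  have "((\<lambda>\<epsilon>. \<phi> (c / (1 - \<epsilon>))) \<longlongrightarrow> \<phi> c) (at_right 0)"
    by (rule isCont_tendsto_compose[OF isCont_phi[OF c_pos]]) (auto intro!: tendsto_eq_intros)
  then have "(\<delta> \<longlongrightarrow> (1 / \<phi> c - 1 / \<phi> c) / w a) (at_right 0)"
    unfolding \<delta>_def using phi_c_pos \<open>0 < w a\<close> by (intro tendsto_intros) auto
  then have \<delta>: "(\<delta> \<longlongrightarrow> 0) (at_right 0)" by simp
  have "\<forall>\<^sub>F \<epsilon> in at_right 0. \<delta> \<epsilon> < s" using order_tendstoD(2)[OF \<delta> s(2)] .
  moreover have "\<forall>\<^sub>F \<epsilon> in at_right 0. \<epsilon> \<in> {0<..<1::real}" by (rule eventually_at_right_real) simp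
  ultimately have "\<forall>\<^sub>F \<epsilon> in at_right 0. V s * (\<phi> u / u) * (a * ((1 - \<epsilon>) * c) - u * \<delta> \<epsilon>) \<le> s"
  proof eventually_elim
    case (elim \<epsilon>)
    then obtain f where f: "near_extremal \<epsilon> f" using ex by auto
    then have [measurable]: "f \<in> borel_measurable M" and F: "lorentz (\<lambda>t. \<phi> \<bar>f t\<bar>) \<le> 1"
      by (auto simp: near_extremal_def modular_eq_lorentz)
    have Q: "(LINT t|M. clipped f t) \<le> \<delta> \<epsilon>"
      using near_extremal_bounds(2)[OF f] elim \<open>0 < w a\<close> by (simp add: \<delta>_def field_simps)
    have "V s * (\<phi> u / u) * (a * ((1 - \<epsilon>) * c) - u * \<delta> \<epsilon>)
        \<le> V s * (\<phi> u / u) * (a * mean f - u * (LINT t|M. clipped f t))"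
      using near_extremal_bounds(1)[OF f] elim Q a u c_pos weight_primitive_nonneg[OF s(1)] phi_nonneg[of u]
      by (intro mult_left_mono diff_mono) auto
    also have "\<dots> \<le> s" using Q elim s u F by (intro concentration) auto
    finally show ?case .
  qed
  moreover have "((\<lambda>\<epsilon>. V s * (\<phi> u / u) * (a * ((1 - \<epsilon>) * c) - u * \<delta> \<epsilon>)) \<longlongrightarrow>
      V s * (\<phi> u / u) * (a * ((1 - 0) * c) - u * 0)) (at_right 0)"
    by (intro tendsto_intros \<delta>)
  ultimately have "V s * (\<phi> u / u) * (a * ((1 - 0) * c) - u * 0) \<le> s"
    by (intro tendsto_upperbound[where F="at_right 0"]) auto
  then have "V s * (\<phi> u / u) * (a * c) \<le> s" by simp
  then have "V s * (\<phi> u / u) \<le> s / (a * c)" using a c_pos by (subst pos_le_divide_eq) auto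
  then have "V s / s * (\<phi> u / u) \<le> 1 / (a * c)"
    using divide_right_mono[of "V s * (\<phi> u / u)" "s / (a * c)" s] s by (simp add: mult_ac)
  also have "\<dots> = V a / a * (\<phi> c / c)" using normalized by (simp add: field_simps)
  finally show ?thesis .
qed

end

subsection \<open>Spaces of classes and the averaging operator\<close>

lemma ae_class_self: "f \<in> borel_measurable N \<Longrightarrow> f \<in> ae_class N f"
  by (simp add: ae_class_def)

lemma mem_ae_class: "g \<in> ae_class N f \<Longrightarrow> g \<in> borel_measurable N \<and> (AE t in N. g t = f t)"
  by (simp add: ae_class_def)

lemma ae_class_eqD:
  "f \<in> borel_measurable N \<Longrightarrow> ae_class N f = ae_class N g \<Longrightarrow> AE t in N. f t = g t"
  by (metis ae_class_self mem_ae_class)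

lemma points_ae_space: "points (ae_space N S n) = ae_class N ` S"
  and vzero_ae_space: "vzero (ae_space N S n) = ae_class N (\<lambda>_. 0)"
  by (simp_all add: ae_space_def)

lemma vadd_ae_class:
  assumes [measurable]: "f \<in> borel_measurable N" "g \<in> borel_measurable N"
  shows "vadd (ae_space N S n) (ae_class N f) (ae_class N g) = ae_class N (\<lambda>t. f t + g t)"
proof -
  have "(\<exists>f'\<in>ae_class N f. \<exists>g'\<in>ae_class N g. AE t in N. h t = f' t + g' t)
      \<longleftrightarrow> (AE t in N. h t = f t + g t)" for h
  proof
    assume "\<exists>f'\<in>ae_class N f. \<exists>g'\<in>ae_class N g. AE t in N. h t = f' t + g' t"
    then obtain f' g' where "AE t in N. f' t = f t" "AE t in N. g' t = g t" "AE t in N. h t = f' t + g' t"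
      by (auto dest: mem_ae_class)
    then show "AE t in N. h t = f t + g t" by eventually_elim simp
  next
    assume "AE t in N. h t = f t + g t"
    then show "\<exists>f'\<in>ae_class N f. \<exists>g'\<in>ae_class N g. AE t in N. h t = f' t + g' t"
      by (intro bexI[of _ f] bexI[of _ g] ae_class_self assms)
  qed
  then show ?thesis by (simp add: ae_space_def ae_class_def)
qed

lemma vscale_ae_class:
  assumes [measurable]: "f \<in> borel_measurable N"
  shows "vscale (ae_space N S n) k (ae_class N f) = ae_class N (\<lambda>t. k * f t)"
proof -
  have "(\<exists>f'\<in>ae_class N f. AE t in N. h t = k * f' t) \<longleftrightarrow> (AE t in N. h t = k * f t)" for h
  proof
    assume "\<exists>f'\<in>ae_class N f. AE t in N. h t = k * f' t"
    then obtain f' where "AE t in N. f' t = f t" "AE t in N. h t = k * f' t"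
      by (auto dest: mem_ae_class)
    then show "AE t in N. h t = k * f t" by eventually_elim simp
  next
    assume "AE t in N. h t = k * f t"
    then show "\<exists>f'\<in>ae_class N f. AE t in N. h t = k * f' t"
      by (intro bexI[of _ f] ae_class_self assms)
  qed
  then show ?thesis by (simp add: ae_space_def ae_class_def)
qed

lemma vnorm_ae_class:
  assumes "f \<in> borel_measurable N"
    and "\<And>g. g \<in> borel_measurable N \<Longrightarrow> (AE t in N. g t = f t) \<Longrightarrow> n g = n f"
  shows "vnorm (ae_space N S n) (ae_class N f) = n f"
proof -
  have "n ` ae_class N f = {n f}"
    using ae_class_self[OF assms(1)] assms(2) by (auto dest: mem_ae_class)
  then show ?thesis by (simp add: ae_space_def)
qed

lemma distribution_cong:
  assumes [measurable]: "f \<in> borel_measurable N" "g \<in> borel_measurable N" and "AE t in N. g t = f t"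
  shows "distribution N g = distribution N f"
proof
  fix s
  show "distribution N g s = distribution N f s"
    unfolding distribution_def using assms(3) by (intro emeasure_eq_AE) auto
qed

lemma luxemburg_norm_cong:
  assumes [measurable]: "f \<in> borel_measurable (meas_I \<gamma>)" "g \<in> borel_measurable (meas_I \<gamma>)"
    and "AE t in meas_I \<gamma>. g t = f t"
  shows "luxemburg_norm \<gamma> \<phi> w g = luxemburg_norm \<gamma> \<phi> w f"
proof -
  have "distribution (meas_I \<gamma>) (\<lambda>t. g t / \<epsilon>) = distribution (meas_I \<gamma>) (\<lambda>t. f t / \<epsilon>)" for \<epsilon>
    using assms(3) by (intro distribution_cong) auto
  then show ?thesis
    by (simp add: luxemburg_norm_def modular_def decreasing_rearrangement_def)
qed

lemma vnorm_orlicz_lorentz: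
  "f \<in> borel_measurable (meas_I \<gamma>) \<Longrightarrow>
    vnorm (orlicz_lorentz \<gamma> \<phi> w) (ae_class (meas_I \<gamma>) f) = luxemburg_norm \<gamma> \<phi> w f"
  unfolding orlicz_lorentz_def by (intro vnorm_ae_class luxemburg_norm_cong)

section \<open>The Luxemburg norm in terms of the modular\<close>

context orlicz_lorentz_space
begin

abbreviation "X \<equiv> orlicz_lorentz \<gamma> \<phi> w"
abbreviation "S \<equiv> orlicz_lorentz_functions \<gamma> \<phi> w"
abbreviation "N \<equiv> luxemburg_norm \<gamma> \<phi> w"

lemma S_measurable: "f \<in> S \<Longrightarrow> f \<in> borel_measurable M"
  by (simp add: orlicz_lorentz_functions_def)

lemma modular_shrink:
  assumes [measurable]: "f \<in> borel_measurable M" and "0 < k" "k \<le> 1"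
  shows "modular \<gamma> \<phi> w (\<lambda>t. k * f t) \<le> ennreal k * modular \<gamma> \<phi> w f"
proof -
  have "modular \<gamma> \<phi> w (\<lambda>t. k * f t) = lorentz (\<lambda>t. \<phi> \<bar>k * f t\<bar>)"
    by (rule modular_eq_lorentz) measurable
  also have "\<dots> \<le> lorentz (\<lambda>t. k * \<phi> \<bar>f t\<bar>)"
    using phi_shrink[of k] assms phi_nonneg by (intro lorentz_mono) (auto simp: abs_mult)
  also have "\<dots> = ennreal k * modular \<gamma> \<phi> w f"
    using assms by (simp add: lorentz_scale modular_eq_lorentz)
  finally show ?thesis .
qed

lemma norm_admissible:
  assumes "f \<in> S"
  obtains r where "0 < r" "modular \<gamma> \<phi> w (\<lambda>t. f t / r) \<le> 1"
proof -
  have [measurable]: "f \<in> borel_measurable M" using S_measurable assms .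
  obtain k where k: "0 < k" "modular \<gamma> \<phi> w (\<lambda>t. k * f t) < \<infinity>"
    using assms by (auto simp: orlicz_lorentz_functions_def)
  then obtain B where B: "0 \<le> B" "modular \<gamma> \<phi> w (\<lambda>t. k * f t) = ennreal B"
    by (cases "modular \<gamma> \<phi> w (\<lambda>t. k * f t)") auto
  \<comment> \<open>Dividing by b \<ge> 1 scales the modular by at most 1 / b, which brings the
    finite value B down to at most 1.\<close>
  define b where "b = max 1 B"
  have "modular \<gamma> \<phi> w (\<lambda>t. 1 / b * (k * f t)) \<le> ennreal (1 / b) * ennreal B"
    unfolding B(2)[symmetric] by (intro modular_shrink) (auto simp: b_def)
  also have "\<dots> \<le> 1" using B by (simp add: b_def max_def flip: ennreal_mult)
  finally show ?thesis using that[of "b / k"] k by (simp add: b_def mult.commute)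
qed

text \<open>The strict inequality avoids the question whether the infimum is attained: some
  admissible q < r exists, and passing from q to r shrinks the function.\<close>

lemma modular_le_1_if_norm_less:
  assumes "f \<in> S" "N f < r"
  shows "modular \<gamma> \<phi> w (\<lambda>t. f t / r) \<le> 1"
proof -
  have [measurable]: "f \<in> borel_measurable M" using S_measurable assms by blast
  have "{\<epsilon>. 0 < \<epsilon> \<and> modular \<gamma> \<phi> w (\<lambda>t. f t / \<epsilon>) \<le> 1} \<noteq> {}"
    using norm_admissible[OF assms(1)] by blast
  from cInf_lessD[OF this, of r] obtain q where q: "0 < q" "modular \<gamma> \<phi> w (\<lambda>t. f t / q) \<le> 1" "q < r"
    using assms(2) by (auto simp: luxemburg_norm_def)
  have "modular \<gamma> \<phi> w (\<lambda>t. q / r * (f t / q)) \<le> ennreal (q / r) * modular \<gamma> \<phi> w (\<lambda>t. f t / q)"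
    using q by (intro modular_shrink) auto
  also have "\<dots> \<le> 1 * 1" using q by (intro mult_mono) auto
  finally show ?thesis using q by simp
qed

lemma norm_le_if_modular_le_1:
  assumes "0 < r" "modular \<gamma> \<phi> w (\<lambda>t. f t / r) \<le> 1"
  shows "N f \<le> r"
  unfolding luxemburg_norm_def using assms by (intro cInf_lower bdd_belowI[of _ 0]) auto

lemma vnorm_X: "f \<in> borel_measurable M \<Longrightarrow> vnorm X (ae_class M f) = N f"
  by (rule vnorm_orlicz_lorentz)

lemmas points_X = points_ae_space[of M S N, folded orlicz_lorentz_def]
lemmas vadd_X = vadd_ae_class[of _ M _ S N, folded orlicz_lorentz_def]
lemmas vscale_X = vscale_ae_class[of _ M S N, folded orlicz_lorentz_def]
lemmas vzero_X = vzero_ae_space[of M S N, folded orlicz_lorentz_def]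

end

section \<open>Averaging over the initial interval as a rank-one operator of norm one\<close>

context normalized_interval
begin

abbreviation "ind \<equiv> (indicator {0..a} :: real \<Rightarrow> real)"

lemma modular_indicator: "modular \<gamma> \<phi> w (\<lambda>t. k * ind t) = ennreal (\<phi> \<bar>k\<bar> * V a)"
proof -
  have "modular \<gamma> \<phi> w (\<lambda>t. k * ind t) = lorentz (\<lambda>t. \<phi> \<bar>k * ind t\<bar>)"
    by (rule modular_eq_lorentz) measurable
  also have "(\<lambda>t. \<phi> \<bar>k * ind t\<bar>) = (\<lambda>t. \<phi> \<bar>k\<bar> * ind t)" by (auto simp: indicator_def)
  finally show ?thesis using a phi_nonneg by (simp add: lorentz_indicator)
qed

lemma indicator_in_S: "(\<lambda>t. k * ind t) \<in> S"
proof -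
  have "modular \<gamma> \<phi> w (\<lambda>t. 1 * (k * ind t)) < \<infinity>" by (simp add: modular_indicator)
  then show ?thesis unfolding orlicz_lorentz_functions_def by (auto intro!: exI[of _ "1::real"])
qed

lemma norm_indicator_le: "N (\<lambda>t. k * ind t) \<le> \<bar>k\<bar> / c"
proof (rule field_le_epsilon)
  fix e :: real assume "0 < e"
  \<comment> \<open>The slack e keeps r positive when k = 0.\<close>
  define r where "r = \<bar>k\<bar> / c + e"
  have "0 < r" using \<open>0 < e\<close> c_pos by (simp add: r_def add_nonneg_pos)
  have "\<bar>k\<bar> \<le> c * r" using \<open>0 < e\<close> c_pos by (simp add: r_def field_simps)
  then have "\<bar>k / r\<bar> \<le> c" using \<open>0 < r\<close> by (simp add: abs_divide pos_divide_le_eq)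
  then have "\<phi> \<bar>k / r\<bar> * V a \<le> \<phi> c * V a" using V_a_pos by (intro mult_right_mono phi_mono) auto
  then have "modular \<gamma> \<phi> w (\<lambda>t. k / r * ind t) \<le> 1" by (simp only: modular_indicator normalized ennreal_le_1)
  then show "N (\<lambda>t. k * ind t) \<le> \<bar>k\<bar> / c + e"
    using norm_le_if_modular_le_1[OF \<open>0 < r\<close>, of "\<lambda>t. k * ind t"] by (simp add: r_def)
qed

lemma integrable_on_initial:
  assumes "f \<in> S"
  shows "integrable M (\<lambda>t. f t * ind t)"
proof -
  have [measurable]: "f \<in> borel_measurable M" using S_measurable assms .
  obtain r where r: "0 < r" "modular \<gamma> \<phi> w (\<lambda>t. f t / r) \<le> 1" using norm_admissible[OF assms] .
  then have "integrable M (\<lambda>t. f t / r * ind t)"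
    using modular_eq_lorentz[of "\<lambda>t. f t / r"] by (intro integrable_if_lorentz_le) simp_all
  from integrable_mult_right[OF this, of r] show ?thesis using r by simp
qed

lemma mean_add: "f \<in> S \<Longrightarrow> g \<in> S \<Longrightarrow> mean (\<lambda>t. f t + g t) = mean f + mean g"
  by (simp add: mean_def integrable_on_initial distrib_right add_divide_distrib)

lemma mean_cmult: "mean (\<lambda>t. k * f t) = k * mean f"
  by (simp add: mean_def mult.assoc)

lemma mean_indicator: "mean (\<lambda>t. k * ind t) = k"
proof -
  have "(LINT t|M. ind t * ind t) = a"
    using a initial_subset by (simp add: measure_def emeasure_Icc Int_absorb2 flip: indicator_inter_arith)
  then show ?thesis using a by (simp add: mean_cmult[of k ind]) (simp add: mean_def)
qed

lemma mean_cong: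
  assumes [measurable]: "f \<in> borel_measurable M" "g \<in> borel_measurable M" and "AE t in M. g t = f t"
  shows "mean g = mean f"
  unfolding mean_def using assms(3)
  by (intro arg_cong[where f="\<lambda>x. x / a"] integral_cong_AE) auto

lemma abs_mean_le_norm:
  assumes "f \<in> S"
  shows "\<bar>mean f\<bar> \<le> c * N f"
proof -
  have [measurable]: "f \<in> borel_measurable M" using S_measurable assms .
  have "\<bar>mean f\<bar> / c \<le> N f"
    unfolding luxemburg_norm_def
  proof (rule cInf_greatest)
    show "{\<epsilon>. 0 < \<epsilon> \<and> modular \<gamma> \<phi> w (\<lambda>t. f t / \<epsilon>) \<le> 1} \<noteq> {}"
      using norm_admissible[OF assms] by blast
    fix r assume r: "r \<in> {\<epsilon>. 0 < \<epsilon> \<and> modular \<gamma> \<phi> w (\<lambda>t. f t / \<epsilon>) \<le> 1}"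
    then have "\<bar>mean (\<lambda>t. f t / r)\<bar> \<le> c"
      using modular_eq_lorentz[of "\<lambda>t. f t / r"] by (intro abs_mean_le) auto
    moreover have "mean (\<lambda>t. f t / r) = mean f / r" using mean_cmult[of "1 / r" f] by simp
    ultimately show "\<bar>mean f\<bar> / c \<le> r" using r c_pos by (simp add: abs_divide field_simps)
  qed
  then show ?thesis using c_pos by (simp add: field_simps)
qed

text \<open>The operator acts on classes, so a representative is chosen; the mean is the same for
  all of them. The minus sign makes the operator work against c times the indicator.\<close>

definition averaging :: "(real \<Rightarrow> real) set \<Rightarrow> (real \<Rightarrow> real) set" where
  "averaging C = ae_class M (\<lambda>t. - mean (SOME f. f \<in> C) * ind t)"

lemma averaging_ae_class:
  assumes "f \<in> borel_measurable M"
  shows "averaging (ae_class M f) = ae_class M (\<lambda>t. - mean f * ind t)"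
proof -
  have "(SOME g. g \<in> ae_class M f) \<in> ae_class M f"
    by (rule someI[of "\<lambda>g. g \<in> ae_class M f", OF ae_class_self[OF assms]])
  then have "mean (SOME g. g \<in> ae_class M f) = mean f"
    using assms by (intro mean_cong) (auto dest: mem_ae_class)
  then show ?thesis by (simp add: averaging_def)
qed

lemma ind_measurable: "(\<lambda>t. k * ind t) \<in> borel_measurable M"
  by measurable

lemma vnorm_averaging:
  assumes "f \<in> S"
  shows "vnorm X (averaging (ae_class M f)) \<le> N f"
proof -
  have "vnorm X (averaging (ae_class M f)) = N (\<lambda>t. - mean f * ind t)"
    by (simp only: averaging_ae_class[OF S_measurable[OF assms]] vnorm_X[OF ind_measurable])
  also have "\<dots> \<le> \<bar>- mean f\<bar> / c" by (rule norm_indicator_le)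
  also have "\<dots> \<le> N f" using abs_mean_le_norm[OF assms] c_pos by (simp add: field_simps)
  finally show ?thesis .
qed

lemma rank_one_averaging: "rank_one X X averaging"
  unfolding rank_one_def bounded_linear_map_def linear_map_def
proof (intro conjI ballI allI)
  fix x assume "x \<in> points X"
  then obtain f where f: "f \<in> S" "x = ae_class M f" by (auto simp: points_X)
  then show "averaging x \<in> points X"
    using indicator_in_S[of "- mean f"]
    by (simp only: averaging_ae_class[OF S_measurable] points_X image_eqI)
  show "averaging (vscale X k x) = vscale X k (averaging x)" for k
  proof -
    have [measurable]: "f \<in> borel_measurable M" using S_measurable f by blast
    have "averaging (vscale X k x) = ae_class M (\<lambda>t. - (k * mean f) * ind t)"
      unfolding f(2) by (subst vscale_X, measurable) (subst averaging_ae_class, measurable, simp only: mean_cmult)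
    also have "\<dots> = vscale X k (averaging x)"
      unfolding f(2) by (subst averaging_ae_class, measurable) (subst vscale_X, measurable, simp add: mult.assoc)
    finally show ?thesis .
  qed
  fix y assume "y \<in> points X"
  then obtain g where g: "g \<in> S" "y = ae_class M g" by (auto simp: points_X)
  show "averaging (vadd X x y) = vadd X (averaging x) (averaging y)"
  proof -
    have [measurable]: "f \<in> borel_measurable M" "g \<in> borel_measurable M" using S_measurable f g by blast+
    have "averaging (vadd X x y) = ae_class M (\<lambda>t. - (mean f + mean g) * ind t)"
      unfolding f(2) g(2)
      by (subst vadd_X, measurable) (subst averaging_ae_class, measurable, simp only: mean_add f g)
    also have "\<dots> = vadd X (averaging x) (averaging y)"
      using f g S_measurable
      by (simp only: averaging_ae_class vadd_X[OF ind_measurable ind_measurable])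
        (simp add: algebra_simps)
    finally show ?thesis .
  qed
next
  show "\<exists>C. \<forall>x\<in>points X. vnorm X (averaging x) \<le> C * vnorm X x"
  proof (intro exI[of _ 1] ballI)
    fix x assume "x \<in> points X"
    then obtain f where f: "f \<in> S" "x = ae_class M f" by (auto simp: points_X)
    then show "vnorm X (averaging x) \<le> 1 * vnorm X x"
      using vnorm_averaging[OF f(1)] by (simp add: vnorm_X S_measurable)
  qed
  let ?y = "ae_class M (\<lambda>t. 1 * ind t)"
  have y: "vscale X k ?y = ae_class M (\<lambda>t. k * ind t)" for k
    using vscale_X[OF ind_measurable, of k 1] by simp
  show "\<exists>y\<in>points X. y \<noteq> vzero X \<and> averaging ` points X = {vscale X k y |k. True}"
  proof (intro bexI[of _ ?y] conjI)
    show "?y \<in> points X" using indicator_in_S by (simp only: points_X image_eqI)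
    show "?y \<noteq> vzero X"
    proof
      assume "?y = vzero X"
      then have "AE t in M. 1 * ind t = 0"
        unfolding vzero_X using ind_measurable by (intro ae_class_eqD)
      then have "mean (\<lambda>t. 1 * ind t) = mean (\<lambda>t. 0 * ind t)"
        by (intro mean_cong ind_measurable) simp
      then show False by (simp only: mean_indicator zero_neq_one)
    qed
    show "averaging ` points X = {vscale X k ?y |k. True}"
    proof (intro set_eqI iffI)
      fix z assume "z \<in> averaging ` points X"
      then obtain f where "f \<in> S" "z = averaging (ae_class M f)" by (auto simp: points_X)
      then have "z = vscale X (- mean f) ?y" by (simp only: averaging_ae_class[OF S_measurable] y)
      then show "z \<in> {vscale X k ?y |k. True}" by blast
    next
      fix z assume "z \<in> {vscale X k ?y |k. True}"
      then obtain k where "z = ae_class M (\<lambda>t. k * ind t)" by (auto simp only: y)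
      then have "z = averaging (ae_class M (\<lambda>t. - k * ind t))"
        by (simp only: averaging_ae_class[OF ind_measurable] mean_indicator minus_minus)
      then show "z \<in> averaging ` points X" using indicator_in_S[of "- k"] by (auto simp only: points_X)
    qed
  qed
qed

text \<open>The test vector is c times the indicator: it lies in the unit ball and is sent to its
  negative, whose norm is at least 1 because its mean has absolute value c.\<close>

lemma op_norm_averaging_ge: "1 \<le> op_norm X X averaging"
proof -
  let ?f = "\<lambda>t. c * ind t"
  have N: "1 \<le> N (\<lambda>t. k * ind t)" if "\<bar>k\<bar> = c" for k
    using abs_mean_le_norm[OF indicator_in_S[of k]] that c_pos by (simp add: mean_indicator)
  have "N ?f \<le> 1" using norm_indicator_le[of c] c_pos by simp
  have "averaging (ae_class M ?f) = ae_class M (\<lambda>t. - c * ind t)"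
    by (simp only: averaging_ae_class[OF ind_measurable] mean_indicator)
  then have "1 \<le> vnorm X (averaging (ae_class M ?f))"
    using N[of "- c"] c_pos by (simp only: vnorm_X[OF ind_measurable] abs_minus_cancel abs_of_pos)
  also have "\<dots> \<le> op_norm X X averaging"
    unfolding op_norm_def
  proof (rule cSup_upper)
    show "vnorm X (averaging (ae_class M ?f)) \<in> {vnorm X (averaging x) |x. x \<in> points X \<and> vnorm X x \<le> 1}"
      using indicator_in_S[of c] \<open>N ?f \<le> 1\<close> vnorm_X[OF ind_measurable, of c]
      by (auto simp: points_X intro!: exI[of _ "ae_class M ?f"])
    \<comment> \<open>A real supremum dominates its members only when the set is bounded.\<close>
    show "bdd_above {vnorm X (averaging x) |x. x \<in> points X \<and> vnorm X x \<le> 1}"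
      using vnorm_averaging
      by (intro bdd_aboveI[of _ 1]) (force simp: points_X vnorm_X S_measurable)
  qed
  finally show ?thesis .
qed

text \<open>The Daugavet equation makes the norm of identity plus averaging at least 2, so some
  class in the unit ball exceeds 2 - \<epsilon>/2. The spare \<epsilon>/2 pays for passing from
  norms to modulars.\<close>

lemma near_extremal_if_daugavet:
  assumes "daugavet_property X" "0 < \<epsilon>" "\<epsilon> < 1"
  shows "\<exists>f. near_extremal \<epsilon> f"
proof -
  let ?A = "{vnorm X (vadd X x (averaging x)) |x. x \<in> points X \<and> vnorm X x \<le> 1}"
  have "op_norm X X (\<lambda>x. vadd X x (averaging x)) = 1 + op_norm X X averaging"
    using assms(1) rank_one_averaging unfolding daugavet_property_def by blast
  then have "2 - \<epsilon> / 2 < Sup ?A"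
    using op_norm_averaging_ge assms unfolding op_norm_def by simp
  moreover have "?A \<noteq> {}"
    using indicator_in_S[of 0] norm_indicator_le[of 0] vnorm_X[OF ind_measurable, of 0]
    by (auto simp: points_X intro!: bexI[of _ "\<lambda>t. 0"])
  ultimately obtain x where x: "x \<in> points X" "vnorm X x \<le> 1" "2 - \<epsilon> / 2 < vnorm X (vadd X x (averaging x))"
    using less_cSupD[of ?A] by blast
  then obtain f where f: "f \<in> S" "x = ae_class M f" by (auto simp: points_X)
  then have [measurable]: "f \<in> borel_measurable M" using S_measurable by blast
  have "N f \<le> 1" using x f by (simp add: vnorm_X)
  have "vadd X x (averaging x) = ae_class M (\<lambda>t. f t + - mean f * ind t)"
    using f S_measurable by (simp only: averaging_ae_class vadd_X[OF _ ind_measurable])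
  with x have big: "2 - \<epsilon> / 2 < N (\<lambda>t. f t - mean f * ind t)" by (simp add: vnorm_X)
  \<comment> \<open>Norm at most 1 < r gives modular at most 1 after division by r, and (2 -
    \<epsilon>) (1 + \<epsilon>/4) \<le> 2 - \<epsilon>/2 keeps the other norm large enough.\<close>
  define r where "r = 1 + \<epsilon> / 4"
  have "0 < r" using assms by (simp add: r_def)
  \<comment> \<open>The sign makes the mean nonnegative; the modular does not see it.\<close>
  define s where "s = (if 0 \<le> mean f then 1 / r else - 1 / r)"
  have s: "\<bar>s\<bar> = 1 / r" using \<open>0 < r\<close> by (simp add: s_def)
  have abs_cong: "modular \<gamma> \<phi> w (\<lambda>t. s * h t) = modular \<gamma> \<phi> w (\<lambda>t. h t / r)" for h
    using s \<open>0 < r\<close>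
    by (simp add: modular_def decreasing_rearrangement_def distribution_def abs_mult)
  have "modular \<gamma> \<phi> w (\<lambda>t. s * f t) \<le> 1"
    unfolding abs_cong using \<open>N f \<le> 1\<close> f assms by (intro modular_le_1_if_norm_less) (auto simp: r_def)
  moreover have "0 \<le> mean (\<lambda>t. s * f t)"
    unfolding mean_cmult using \<open>0 < r\<close> by (auto simp: s_def intro: divide_nonpos_pos)
  moreover have "1 < modular \<gamma> \<phi> w (\<lambda>t. (s * f t - mean (\<lambda>t. s * f t) * ind t) / (2 - \<epsilon>))"
  proof (rule ccontr)
    assume *: "\<not> ?thesis"
    have "(\<lambda>t. (s * f t - mean (\<lambda>t. s * f t) * ind t) / (2 - \<epsilon>)) = (\<lambda>t. s * ((f t - mean f * ind t) / (2 - \<epsilon>)))"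
      by (auto simp: mean_cmult algebra_simps)
    with * have "modular \<gamma> \<phi> w (\<lambda>t. (f t - mean f * ind t) / (2 - \<epsilon>) / r) \<le> 1"
      by (simp only: abs_cong not_less)
    then have "N (\<lambda>t. f t - mean f * ind t) \<le> (2 - \<epsilon>) * r"
      using assms \<open>0 < r\<close> by (intro norm_le_if_modular_le_1) (auto simp: divide_divide_eq_left)
    also have "\<dots> \<le> 2 - \<epsilon> / 2" using assms by (simp add: r_def algebra_simps)
    finally show False using big by simp
  qed
  ultimately have "near_extremal \<epsilon> (\<lambda>t. s * f t)" by (simp add: near_extremal_def)
  then show ?thesis by (rule exI[of _ "\<lambda>t. s * f t"])
qed

end

subsection \<open>Rigidity\<close>

lemma vnorm_L1:
  "f \<in> borel_measurable (meas_I \<gamma>) \<Longrightarrow>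
    vnorm (L1_space \<gamma>) (ae_class (meas_I \<gamma>) f) = (LINT t|meas_I \<gamma>. \<bar>f t\<bar>)"
  unfolding L1_space_def
proof (rule vnorm_ae_class)
  fix g assume [measurable]: "f \<in> borel_measurable (meas_I \<gamma>)" "g \<in> borel_measurable (meas_I \<gamma>)"
    and "AE t in meas_I \<gamma>. g t = f t"
  then show "(LINT t|meas_I \<gamma>. \<bar>g t\<bar>) = (LINT t|meas_I \<gamma>. \<bar>f t\<bar>)"
    by (intro integral_cong_AE) auto
qed

context weighted_interval
begin

lemma primitive_const:
  assumes w: "\<And>t. t \<in> I \<Longrightarrow> 0 < t \<Longrightarrow> w t = k" and x: "x \<le> emeasure M I"
  shows "primitive x = ennreal k * x"
proof -
  have "{t \<in> space M. ennreal t < x} \<in> sets M" by measurable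
  then have [measurable]: "{t \<in> I. ennreal t < x} \<in> sets M" by simp
  have "primitive x = (\<integral>\<^sup>+t. ennreal k * indicator {t \<in> I. ennreal t < x} t \<partial>M)"
    unfolding primitive_def
  proof (rule nn_integral_cong_AE)
    show "AE t in M. ennreal (w t) * indicator {t. ennreal t < x} t
        = ennreal k * indicator {t \<in> I. ennreal t < x} t"
      using AE_nonzero AE_space
    proof eventually_elim
      case (elim t)
      then show ?case using w[of t] by (auto simp: indicator_def I_iff)
    qed
  qed
  also have "\<dots> = ennreal k * x" by (simp add: nn_integral_cmult emeasure_initial[OF x])
  finally show ?thesis .
qed

lemma lorentz_const:
  assumes "\<And>t. t \<in> I \<Longrightarrow> 0 < t \<Longrightarrow> w t = k" and [measurable]: "f \<in> borel_measurable M"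
  shows "lorentz f = ennreal k * (\<integral>\<^sup>+t. ennreal \<bar>f t\<bar> \<partial>M)"
proof -
  have "lorentz f = (\<integral>\<^sup>+s. ennreal k * (distribution M f s * indicator {0<..} s) \<partial>lborel)"
    unfolding lorentz_def
    by (simp add: primitive_const[OF assms(1) distribution_le_I] mult.assoc)
  also have "\<dots> = ennreal k * (\<integral>\<^sup>+t. ennreal \<bar>f t\<bar> \<partial>M)"
    by (simp add: nn_integral_cmult layer_cake_abs[OF sigma_finite_M])
  finally show ?thesis .
qed

lemma exists_larger:
  assumes "t \<in> I"
  obtains y where "t < y" "y \<in> I"
proof -
  obtain y where "ereal t < ereal y" "ereal y < \<gamma>"
    using assms ereal_dense2 unfolding I_iff by blast
  then show ?thesis using that[of y] assms by (simp add: I_iff)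
qed

text \<open>w(t) is at most the average of w to its left and at least its average over an interval
  to its right; both averages equal k.\<close>

lemma weight_const_if_slope_const:
  assumes slope: "\<And>t. t \<in> I \<Longrightarrow> 0 < t \<Longrightarrow> V t = k * t" and t: "t \<in> I" "0 < t"
  shows "w t = k"
proof (rule antisym)
  show "w t \<le> k" using weight_primitive_ge[of t] slope[OF t] t by simp
  obtain y where y: "t < y" "y \<in> I" using exists_larger[OF t(1)] .
  have "k * (y - t) \<le> w t * (y - t)"
    using weight_primitive_diff_le[of y t] slope[OF t] slope[of y] t y by (simp add: algebra_simps)
  then show "k \<le> w t" using y by simp
qed

text \<open>For \<gamma> = 1 the endpoint 1 lies outside I, and w is unconstrained there and at 0;
  both points are null.\<close>

lemma weight_primitive_1_const:
  assumes w: "\<And>t. t \<in> I \<Longrightarrow> 0 < t \<Longrightarrow> w t = k" and "1 \<le> \<gamma>"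
  shows "V 1 = k"
proof -
  have "AE t in lebesgue. t \<noteq> (1::real) \<and> t \<noteq> 0"
    using AE_lborel_singleton[of 1] AE_lborel_singleton[of 0] by (intro AE_completion AE_conjI)
  then have "AE t in lebesgue. t \<in> {0..1} \<longrightarrow> w t = k"
  proof eventually_elim
    case (elim t)
    show ?case
    proof
      assume "t \<in> {0..1}"
      then have "ereal t < ereal 1" using elim by simp
      then have "ereal t < \<gamma>"
        using less_le_trans[of "ereal t" "ereal 1" \<gamma>] \<open>1 \<le> \<gamma>\<close> by (simp only: one_ereal_def)
      with \<open>t \<in> {0..1}\<close> elim w[of t] show "w t = k" by (simp add: I_iff)
    qed
  qed
  then have eq: "AE t in lebesgue. indicator {0..1} t *\<^sub>R k = indicator {0..1} t *\<^sub>R w t"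
    by eventually_elim (simp add: indicator_def)
  have meas: "(\<lambda>t::real. indicator {0..1} t *\<^sub>R k) \<in> borel_measurable lebesgue"
    by (intro measurable_completion) measurable
  have "(LINT t|lebesgue. indicator {0..1::real} t *\<^sub>R k) = V 1"
    unfolding weight_primitive_def set_lebesgue_integral_def
    by (intro integral_cong_AE meas borel_measurable_AE[OF meas eq] eq)
  moreover have "(LINT t|lebesgue. indicator {0..1::real} t *\<^sub>R k) = k" by simp
  ultimately show ?thesis by simp
qed

end

context orlicz
begin

lemma phi_linear_if_eventually:
  assumes "0 < c" and up: "\<And>u. c \<le> u \<Longrightarrow> \<phi> u = k * u" and "0 \<le> u" and "0 < k"
  shows "\<phi> u = k * u"
proof (cases "u < c \<and> u \<noteq> 0")
  case True
  then have u: "0 < u" "u < c" using assms by auto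
  have "\<phi> u / u \<le> k" using phi_ratio_mono[of u c] u up[of c] by simp
  then have "\<phi> u \<le> k * u" using u by (simp add: field_simps)
  moreover have "k * u \<le> \<phi> u"
  proof -
    \<comment> \<open>The weight that exhibits c as a convex combination of u and 2 c. As \<phi> is
      known at c and 2 c, convexity bounds \<phi> u from below; the upper bound came from the chord
      slopes.\<close>
    define x where "x = c / (2 * c - u)"
    have "x * (2 * c - u) = c" using u by (simp add: x_def)
    then have "x * u + (1 - x) * (2 * c) = c" by (simp add: algebra_simps)
    moreover have "0 < x" "x \<le> 1" using u by (simp_all add: x_def)
    ultimately have x: "0 < x" "x \<le> 1" "x * u + (1 - x) * (2 * c) = c" by simp_all
    have "k * (x * u + (1 - x) * (2 * c)) \<le> x * \<phi> u + (1 - x) * \<phi> (2 * c)"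
      using phi_convex_comb[of x u "2 * c"] x u up[of c] by simp
    also have "\<phi> (2 * c) = k * (2 * c)" using u by (intro up) simp
    finally have "x * (k * u) \<le> x * \<phi> u" by (simp add: algebra_simps)
    then show ?thesis using x by simp
  qed
  ultimately show ?thesis by simp
next
  case False
  then show ?thesis using up[of u] \<open>0 \<le> u\<close> by (cases "u = 0") simp_all
qed

end

context orlicz_lorentz_space
begin

lemma daugavet_imp_linear:
  assumes "daugavet_property X"
  shows "\<exists>k>0. \<exists>l>0. (\<forall>t\<in>I. 0 < t \<longrightarrow> w t = k) \<and> (\<forall>u\<ge>0. \<phi> u = l * u)"
proof -
  have "0 \<in> I" using \<gamma>_pos by (simp add: I_iff zero_ereal_def)
  then obtain b where b: "0 < b" "b \<in> I" using exists_larger by blast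
  \<comment> \<open>The height c depends on a, so each a brings its own instance of the normalized
    setting.\<close>
  have slopes: "\<exists>c>0. 0 < \<phi> c \<and> (\<forall>s u. s \<in> I \<longrightarrow> 0 < s \<longrightarrow> c \<le> u \<longrightarrow>
      V s / s * (\<phi> u / u) \<le> V a / a * (\<phi> c / c))" if a: "a \<in> I" "0 < a" for a
  proof -
    have "0 < V a" using a by (intro weight_primitive_pos)
    then obtain c where c: "0 < c" "\<phi> c = 1 / V a" using phi_surj[of "1 / V a"] by auto
    interpret normalized_interval \<gamma> w \<phi> a c
      using a c \<open>0 < V a\<close> by unfold_locales auto
    show ?thesis
      using c(1) phi_c_pos extremal_slopes[OF near_extremal_if_daugavet[OF assms]] by blast
  qed
  have slope_le: "V s / s \<le> V a / a" if as: "a \<in> I" "0 < a" "s \<in> I" "0 < s" for a s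
  proof -
    obtain c where c: "0 < c" "0 < \<phi> c" "V s / s * (\<phi> c / c) \<le> V a / a * (\<phi> c / c)"
      using slopes[OF as(1,2)] as by blast
    then show ?thesis by (metis mult_le_cancel_right_pos divide_pos_pos)
  qed
  define k where "k = V b / b"
  \<comment> \<open>\<open>slope_le\<close> holds for every pair of points, so exchanging the two
    gives equality.\<close>
  have "V t = k * t" if "t \<in> I" "0 < t" for t
    using slope_le[of b t] slope_le[of t b] b that by (simp add: k_def field_simps)
  then have w: "w t = k" if "t \<in> I" "0 < t" for t using that by (rule weight_const_if_slope_const)
  have "0 < k" using w_pos[of b] w[of b] b by simp
  obtain c where c: "0 < c" "0 < \<phi> c"
    "\<And>s u. s \<in> I \<Longrightarrow> 0 < s \<Longrightarrow> c \<le> u \<Longrightarrow> V s / s * (\<phi> u / u) \<le> V b / b * (\<phi> c / c)"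
    using slopes[of b] b by blast
  define l where "l = \<phi> c / c"
  have "0 < l" using c by (simp add: l_def)
  have "\<phi> u = l * u" if "c \<le> u" for u
  proof -
    have "k * (\<phi> u / u) \<le> k * l" using c(3)[of b u] b that by (simp add: k_def l_def)
    then have "\<phi> u / u \<le> l" using \<open>0 < k\<close> by (rule mult_left_le_imp_le)
    then have "\<phi> u / u = l" using phi_ratio_mono[of c u] c(1) that by (simp add: l_def)
    then show ?thesis using c(1) that by (simp add: field_simps)
  qed
  then have "\<phi> u = l * u" if "0 \<le> u" for u
    using phi_linear_if_eventually[OF c(1) _ that \<open>0 < l\<close>] by blast
  then show ?thesis using \<open>0 < k\<close> \<open>0 < l\<close> w by blast
qed

text \<open>The modular is then l k times the L1 norm, hence homogeneous, and the Luxemburg norm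
  coincides with it.\<close>

lemma norm_eq_L1_if_linear:
  assumes k: "0 < k" "\<And>t. t \<in> I \<Longrightarrow> 0 < t \<Longrightarrow> w t = k"
    and l: "0 < l" "\<And>u. 0 \<le> u \<Longrightarrow> \<phi> u = l * u"
  shows "S = {f. integrable M f}" and "\<And>f :: real \<Rightarrow> real. integrable M f \<Longrightarrow> N f = l * k * (LINT t|M. \<bar>f t\<bar>)"
proof -
  have modular: "modular \<gamma> \<phi> w f = ennreal (l * k) * (\<integral>\<^sup>+t. ennreal \<bar>f t\<bar> \<partial>M)"
    if [measurable]: "f \<in> borel_measurable M" for f
  proof -
    have "modular \<gamma> \<phi> w f = lorentz (\<lambda>t. l * \<bar>f t\<bar>)" by (simp add: modular_eq_lorentz l)
    also have "\<dots> = ennreal l * (ennreal k * (\<integral>\<^sup>+t. ennreal \<bar>\<bar>f t\<bar>\<bar> \<partial>M))"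
      using k l by (simp add: lorentz_scale lorentz_const[OF k(2)])
    also have "\<dots> = ennreal (l * k) * (\<integral>\<^sup>+t. ennreal \<bar>f t\<bar> \<partial>M)"
      using k l by (simp add: ennreal_mult mult.assoc)
    finally show ?thesis .
  qed
  have lk: "0 < l * k" using k l by simp
  show "S = {f. integrable M f}"
  proof (intro set_eqI iffI)
    fix f assume "f \<in> S"
    then have [measurable]: "f \<in> borel_measurable M" by (rule S_measurable)
    obtain c where c: "0 < c" "modular \<gamma> \<phi> w (\<lambda>t. c * f t) < \<infinity>"
      using \<open>f \<in> S\<close> by (auto simp: orlicz_lorentz_functions_def)
    then have "(\<integral>\<^sup>+t. ennreal \<bar>c * f t\<bar> \<partial>M) < \<infinity>"
      using lk by (auto simp: modular ennreal_mult_less_top)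
    then have "integrable M (\<lambda>t. c * f t)" by (intro integrableI_bounded) auto
    then show "f \<in> {f. integrable M f}" using c by simp
  next
    fix f :: "real \<Rightarrow> real" assume "f \<in> {f. integrable M f}"
    then have f: "integrable M f" and [measurable]: "f \<in> borel_measurable M" by auto
    have "modular \<gamma> \<phi> w (\<lambda>t. 1 * f t) < \<infinity>"
      using f by (simp add: modular integrable_iff_bounded ennreal_mult_less_top)
    then show "f \<in> S" unfolding orlicz_lorentz_functions_def by (auto intro!: exI[of _ "1::real"])
  qed
  fix f :: "real \<Rightarrow> real" assume f: "integrable M f"
  then have [measurable]: "f \<in> borel_measurable M" by auto
  define J where "J = l * k * (LINT t|M. \<bar>f t\<bar>)"
  have "0 \<le> J" using lk by (simp add: J_def)
  have "modular \<gamma> \<phi> w (\<lambda>t. f t / \<epsilon>) \<le> 1 \<longleftrightarrow> J \<le> \<epsilon>" if "0 < \<epsilon>" for \<epsilon>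
  proof -
    have "(\<integral>\<^sup>+t. ennreal \<bar>f t / \<epsilon>\<bar> \<partial>M) = ennreal (LINT t|M. \<bar>f t / \<epsilon>\<bar>)"
      using f by (intro nn_integral_eq_integral) auto
    also have "(LINT t|M. \<bar>f t / \<epsilon>\<bar>) = (LINT t|M. \<bar>f t\<bar>) / \<epsilon>"
      using that by (simp add: abs_divide)
    finally have "modular \<gamma> \<phi> w (\<lambda>t. f t / \<epsilon>) = ennreal (J / \<epsilon>)"
      using lk that by (simp add: modular J_def flip: ennreal_mult)
    then show ?thesis using that by (simp add: field_simps)
  qed
  then have set: "{\<epsilon>. 0 < \<epsilon> \<and> modular \<gamma> \<phi> w (\<lambda>t. f t / \<epsilon>) \<le> 1} = {\<epsilon>. 0 < \<epsilon> \<and> J \<le> \<epsilon>}" by auto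
  show "N f = J"
    unfolding luxemburg_norm_def set
  proof (cases "J = 0")
    case True
    then have "{\<epsilon>. 0 < \<epsilon> \<and> J \<le> \<epsilon>} = {0<..}" by auto
    with True show "Inf {\<epsilon>. 0 < \<epsilon> \<and> J \<le> \<epsilon>} = J" by simp
  next
    case False
    then have "{\<epsilon>. 0 < \<epsilon> \<and> J \<le> \<epsilon>} = {J..}" using \<open>0 \<le> J\<close> by auto
    then show "Inf {\<epsilon>. 0 < \<epsilon> \<and> J \<le> \<epsilon>} = J" by simp
  qed
qed

text \<open>Both spaces consist of the same classes and their norms are proportional, so
  multiplication by the factor K is the isometry.\<close>

lemma isometric_L1_if_norm_eq:
  assumes S: "S = {f. integrable M f}" and K: "0 < K"
    and N: "\<And>f. integrable M f \<Longrightarrow> N f = K * (LINT t|M. \<bar>f t\<bar>)"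
  shows "isometrically_isomorphic X (L1_space \<gamma>)"
  unfolding isometrically_isomorphic_def
proof (intro exI[of _ "vscale X K"] conjI)
  have points: "points X = ae_class M ` {f. integrable M f}"
    "points (L1_space \<gamma>) = ae_class M ` {f. integrable M f}"
    by (simp_all add: points_X S L1_space_def points_ae_space)
  \<comment> \<open>The operations on classes depend on the measure alone, so all algebra can be
    done in X.\<close>
  have vadd: "vadd (L1_space \<gamma>) = vadd X" and vscale: "vscale (L1_space \<gamma>) = vscale X"
    by (simp_all add: L1_space_def orlicz_lorentz_def ae_space_def)
  have scale: "vscale X r (ae_class M f) = ae_class M (\<lambda>t. r * f t)" if "integrable M f" for r f
    using that by (intro vscale_X) auto
  have closed: "vscale X r x \<in> points X" if "x \<in> points X" for r x
    using that by (auto simp: points scale)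
  have assoc: "vscale X r (vscale X s x) = vscale X (r * s) x" if "x \<in> points X" for r s x
    using that by (auto simp: points scale mult.assoc)
  have one: "vscale X 1 x = x" if "x \<in> points X" for x
    using that by (auto simp: points scale)
  show "linear_map X (L1_space \<gamma>) (vscale X K)"
    unfolding linear_map_def vadd vscale
  proof (intro conjI ballI allI)
    fix x assume x: "x \<in> points X"
    then show "vscale X K x \<in> points (L1_space \<gamma>)" using closed points by simp
    show "vscale X K (vscale X r x) = vscale X r (vscale X K x)" for r
      using x by (simp add: assoc mult.commute)
    fix y assume y: "y \<in> points X"
    obtain f g where "integrable M f" "x = ae_class M f" "integrable M g" "y = ae_class M g"
      using x y by (auto simp: points)
    then show "vscale X K (vadd X x y) = vadd X (vscale X K x) (vscale X K y)"
      by (simp add: scale vadd_X distrib_left)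
  qed
  show "bij_betw (vscale X K) (points X) (points (L1_space \<gamma>))"
  proof (rule bij_betw_byWitness[where f' = "vscale X (1 / K)"])
    show "\<forall>x\<in>points X. vscale X (1 / K) (vscale X K x) = x"
      using K by (simp add: assoc one)
    show "\<forall>x\<in>points (L1_space \<gamma>). vscale X K (vscale X (1 / K) x) = x"
      using K by (simp add: assoc one points(2)[folded points(1)])
  qed (use closed points in auto)
  show "\<forall>x\<in>points X. vnorm (L1_space \<gamma>) (vscale X K x) = vnorm X x"
  proof
    fix x assume "x \<in> points X"
    then obtain f where f: "integrable M f" "x = ae_class M f" by (auto simp: points)
    then show "vnorm (L1_space \<gamma>) (vscale X K x) = vnorm X x"
      using K by (simp add: scale vnorm_L1 vnorm_X N abs_mult)
  qed
qed

end

text \<open>W(1) = 1 fixes the constant weight as 1 but leaves the slope of \<phi> free. That slope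
  is \<phi> 1, hence the factor in the norm identity and the equality of norms under the
  normalization \<phi> 1 = 1. The condition 1 \<le> \<gamma> ensures that W(1) involves w on I only,
  up to a null set.\<close>

theorem theorem4p9:
  fixes \<gamma> :: ereal and \<phi> w :: "real \<Rightarrow> real"
  assumes "0 < \<gamma>"
    and "orlicz_function \<phi>"
    and "weight_function \<gamma> w"
    and "regular_weight \<gamma> w"
    and "daugavet_property (orlicz_lorentz \<gamma> \<phi> w)"
  shows "isometrically_isomorphic (orlicz_lorentz \<gamma> \<phi> w) (L1_space \<gamma>) \<and>
    (1 \<le> \<gamma> \<and> weight_primitive w 1 = 1 \<longrightarrow>
       points (orlicz_lorentz \<gamma> \<phi> w) = points (L1_space \<gamma>) \<and>
       (\<forall>x\<in>points (L1_space \<gamma>).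
          vnorm (orlicz_lorentz \<gamma> \<phi> w) x = \<phi> 1 * vnorm (L1_space \<gamma>) x) \<and>
       (\<phi> 1 = 1 \<longrightarrow> (\<forall>x\<in>points (L1_space \<gamma>).
          vnorm (orlicz_lorentz \<gamma> \<phi> w) x = vnorm (L1_space \<gamma>) x)))"
proof -
  interpret orlicz_lorentz_space \<gamma> w \<phi>
    using assms by unfold_locales
  obtain k l where k: "0 < k" "\<And>t. t \<in> I \<Longrightarrow> 0 < t \<Longrightarrow> w t = k"
    and l: "0 < l" "\<And>u. 0 \<le> u \<Longrightarrow> \<phi> u = l * u"
    using daugavet_imp_linear[OF assms(5)] by blast
  note norm = norm_eq_L1_if_linear[OF k l]
  have "isometrically_isomorphic X (L1_space \<gamma>)"
    using k l by (intro isometric_L1_if_norm_eq[OF norm(1) _ norm(2)]) auto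
  moreover have points: "points X = points (L1_space \<gamma>)"
    by (simp add: points_X norm(1) L1_space_def points_ae_space)
  moreover have "vnorm X x = \<phi> 1 * vnorm (L1_space \<gamma>) x"
    if one: "1 \<le> \<gamma>" "V 1 = 1" and x: "x \<in> points (L1_space \<gamma>)" for x
  proof -
    have "k = 1" using weight_primitive_1_const[OF k(2) one(1)] one(2) by simp
    obtain f where "integrable M f" "x = ae_class M f"
      using x by (auto simp: L1_space_def points_ae_space)
    then show ?thesis using l(2)[of 1] by (simp add: \<open>k = 1\<close> vnorm_X vnorm_L1 norm(2))
  qed
  ultimately show ?thesis by auto
qed

end
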